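(* Let $n$ be a nonnegative integer and suppose $bcd=a^2q$ and $ef=aq^{n+1}$. Then \begin{multline*} \sum_{k=0}^n\frac{E(aq^{3k})}{E(a)} \frac{(b,c,d;q^2,p)_k}{(aq/b,aq/c,aq/d;q,p)_k} \frac{(e,f,q^{-n};q,p)_k}{(aq^2/e,aq^2/f,aq^{n+2};q^2,p)_k}\, q^k \\ =\frac{(aq,aq/bc;q,p)_n\,(aq^{1-n}/b,aq^{1-n}/c;q^2,p)_n} {(aq/b,aq/c;q,p)_n\,(aq^{1-n},aq^{1-n}/bc;q^2,p)_n} \,{_{10}\omega_9}(a^2/ef;b,c,d,a/e,a/f,q^{1-n},q^{-n};q^2,p). \end{multline*}
   Context: Let $p$ be a complex number with $|p|<1$, $q$ a nonzero complex number, and all parameters generic so that no denominator vanishes. For nonzero $x$, $E(x)=E(x;p)=\prod_{k\ge 0}(1-xp^k)(1-p^{k+1}/x)$. For a nonzero base $Q$ and integer $m$, $(a;Q,p)_m=\prod_{k=0}^{m-1}E(aQ^k)$ if $m>0$, $=1$ if $m=0$, and $=1/\prod_{k=0}^{-m-1}E(aQ^{m+k})$ if $m<0$; $(a_1,\dots,a_s;Q,p)_m=\prod_{i=1}^s(a_i;Q,p)_m$. For parameters with $(a_4\cdots a_{r+1})^2=a_1^{r-3}Q^{r-5}$ and one of $a_4,\dots,a_{r+1}$ of the form $Q^{-N}$ ($N$ a nonnegative integer), \[{_{r+1}\omega_r}(a_1;a_4,\dots,a_{r+1};Q,p)=\sum_{k\ge 0}\frac{E(a_1Q^{2k})}{E(a_1)}\frac{(a_1,a_4,\dots,a_{r+1};Q,p)_k\,Q^k}{(Q,a_1Q/a_4,\dots,a_1Q/a_{r+1};Q,p)_k}.\]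 (In the ${_{10}\omega_9}$ above, whichever of $q^{1-n},q^{-n}$ is an integer power $q^{-2N}$ of the base $q^2$ makes the series terminate.) *)

theory Defs
  imports "HOL-Analysis.Analysis"
begin

definition Etheta :: "complex \<Rightarrow> complex \<Rightarrow> complex" where
  "Etheta p x = (\<Prod>k. (1 - x * p ^ k) * (1 - p ^ (k + 1) / x))"

definition tpoch :: "complex \<Rightarrow> complex \<Rightarrow> complex \<Rightarrow> int \<Rightarrow> complex" where
  "tpoch p Q a m =
     (if m \<ge> 0 then (\<Prod>k<nat m. Etheta p (a * Q ^ k))
      else 1 / (\<Prod>k<nat (- m). Etheta p (a * Q powi (m + int k))))"

definition tpochs :: "complex \<Rightarrow> complex \<Rightarrow> complex list \<Rightarrow> int \<Rightarrow> complex" where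
  "tpochs p Q as m = (\<Prod>a\<leftarrow>as. tpoch p Q a m)"

text \<open>The series {r+1}omega_r(a1; a4,...,a_{r+1}; Q, p), parameters a4..a_{r+1} given as a list.
  (Used only in the terminating, balanced situation of the paper.)\<close>
definition omega :: "complex \<Rightarrow> complex \<Rightarrow> complex \<Rightarrow> complex list \<Rightarrow> complex" where
  "omega p Q a1 as =
     (\<Sum>k. Etheta p (a1 * Q ^ (2 * k)) / Etheta p a1
        * tpochs p Q (a1 # as) (int k) * Q ^ k
        / tpochs p Q (Q # map (\<lambda>ai. a1 * Q / ai) as) (int k))"

end

theory Submission
  imports Defs "HOL-Complex_Analysis.Complex_Analysis"
begin

text \<open>
  In additive notation \<open>q = exp h\<close>, \<open>a = exp \<alpha>\<close> and so on, theta functions become an odd entire function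
  that satisfies Weierstrass' addition formula, which is the only analytic input (Liouville's theorem).
  For \<open>e = a\<close> the left-hand side is a quadratic summation: it is a Newton-type expansion in
  the variable \<open>b\<close>, \<open>bc\<close> being fixed, whose coefficients satisfy a Pascal-type recursion that is a single
  instance of the addition formula. In general, with \<open>ef\<close> fixed, every summand on the left is a ratio of
  brackets in \<open>e\<close> and has a partial fraction expansion; after interchanging the sums, the coefficient of the
  \<open>j\<close>-th pole is again a quadratic summation, with \<open>a, b, c, d, n\<close> replaced by
  \<open>aq\<^sup>3\<^sup>j, bq\<^sup>2\<^sup>j, cq\<^sup>2\<^sup>j, dq\<^sup>2\<^sup>j, n - j\<close>, and this is the \<open>j\<close>-th term of the series on the right
  (and zero if \<open>2j > n\<close>). The argument needs generic parameters, and the general case follows by continuity.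
\<close>

section \<open>The odd theta function\<close>

text \<open>The product \<open>s (x + y) * s (x - y)\<close>, the bracket, replaces the difference
  of two points: as functions of \<open>y\<close> all brackets lie in one two-dimensional space,
  which is the content of the addition formula, so interpolation and partial fractions carry over to
  theta functions. For this reason parameters occur in pairs, \<open>b\<close> with \<open>c\<close>
  and \<open>e\<close> with \<open>f\<close>: half the difference of their logarithms is the
  variable, half their sum enters the nodes. The case \<open>e = a\<close> returns inside the
  general one because the residues at the \<open>j\<close>-th pole of the summands
  \<open>j + i\<close> supply, as functions of \<open>i\<close>, exactly the factors in
  \<open>aq^(3j)\<close> and \<open>q^(n-j+1)\<close> that take the place of those in
  \<open>e\<close> and \<open>f\<close>. Both the Newton induction and these inner sums move the
  parameters by multiples of \<open>h\<close>, so genericity has to be demanded for all such shifts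
  at once. Another obstacle is that logarithms are determined only modulo
  \<open>2 * pi * \<i>\<close>, while the balancing conditions must hold exactly in additive
  form.\<close>

definition qpoch_inf :: "complex \<Rightarrow> complex \<Rightarrow> complex" where
  "qpoch_inf p x = (\<Prod>k. 1 - x * p ^ k)"

lemma convergent_qpoch_inf:
  assumes "norm p < 1"
  shows "convergent_prod (\<lambda>k. 1 - x * p ^ k :: complex)"
proof -
  have "summable (\<lambda>k. norm x * norm p ^ k)"
    by (intro summable_mult summable_geometric) (use assms in auto)
  then have "summable (\<lambda>k. norm ((1 - x * p ^ k) - 1))"
    by (simp add: norm_mult norm_power)
  then show ?thesis
    by (intro abs_convergent_prod_imp_convergent_prod summable_imp_abs_convergent_prod)
qed

text \<open>A convergent infinite product is nonzero unless one of its factors is zero.\<close>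

lemma qpoch_inf_eq_0_iff:
  assumes "norm p < 1"
  shows "qpoch_inf p x = 0 \<longleftrightarrow> (\<exists>k. x * p ^ k = 1)"
proof
  assume "qpoch_inf p x = 0"
  then obtain k where "1 - x * p ^ k = 0"
    using prodinf_nonzero[OF convergent_qpoch_inf[OF assms, of x]]
    unfolding qpoch_inf_def by blast
  then show "\<exists>k. x * p ^ k = 1" by auto
next
  assume "\<exists>k. x * p ^ k = 1"
  then obtain k where "1 - x * p ^ k = 0" by auto
  then show "qpoch_inf p x = 0"
    using has_prod_eq_0_iff[OF convergent_prod_has_prod[OF convergent_qpoch_inf[OF assms, of x]]]
    unfolding qpoch_inf_def by (metis UNIV_I image_eqI)
qed

lemma qpoch_inf_rec:
  assumes "norm p < 1"
  shows "qpoch_inf p x = (1 - x) * qpoch_inf p (p * x)"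
\<comment> \<open>At \<open>x = 1\<close> the head factor is zero and cannot be divided out; both
  sides vanish.\<close>
proof (cases "x = 1")
  case True
  then have "\<exists>k. x * p ^ k = 1" by (intro exI[of _ 0]) auto
  then have "qpoch_inf p x = 0" using qpoch_inf_eq_0_iff[OF assms] by blast
  then show ?thesis using True by simp
next
  case False
  then show ?thesis
    using prodinf_split_head[OF convergent_qpoch_inf[OF assms, of x]]
    by (simp add: qpoch_inf_def field_simps)
qed

text \<open>On each closed disc of radius 1 the partial products converge uniformly, by comparison
  with a geometric series.\<close>

lemma holomorphic_qpoch_inf:
  assumes "norm p < 1"
  shows "qpoch_inf p holomorphic_on UNIV"
proof (rule holomorphic_uniform_sequence)
  fix z :: complex
  let ?P = "\<lambda>N z. \<Prod>n<N. 1 - z * p ^ n"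
  have "uniformly_convergent_on (cball z 1) ?P"
  proof (rule uniformly_convergent_on_prod')
    show "uniformly_convergent_on (cball z 1) (\<lambda>N x. \<Sum>n<N. norm (1 - x * p ^ n - 1))"
    proof (rule Weierstrass_m_test')
      show "summable (\<lambda>n. (norm z + 1) * norm p ^ n)"
        by (intro summable_mult summable_geometric) (use assms in auto)
      fix n x assume "x \<in> cball z 1"
      then have "norm x \<le> norm z + 1"
        using norm_triangle_ineq2[of x z] by (auto simp: dist_norm norm_minus_commute)
      then show "norm (norm (1 - x * p ^ n - 1)) \<le> (norm z + 1) * norm p ^ n"
        by (simp add: norm_mult norm_power mult_right_mono)
    qed
  qed (auto intro!: continuous_intros)
  then obtain g where g: "uniform_limit (cball z 1) ?P g sequentially"
    by (auto simp: uniformly_convergent_on_def)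
  also have "?this \<longleftrightarrow> uniform_limit (cball z 1) ?P (qpoch_inf p) sequentially"
  proof (intro uniform_limit_cong)
    fix x assume "x \<in> cball z 1"
    then have "(\<lambda>n. ?P (Suc n) x) \<longlonglongrightarrow> g x"
      by (intro LIMSEQ_Suc tendsto_uniform_limitI[OF g])
    moreover have "(\<lambda>n. ?P (Suc n) x) \<longlonglongrightarrow> qpoch_inf p x"
      using convergent_prod_LIMSEQ[OF convergent_qpoch_inf[OF assms, of x]]
      unfolding lessThan_Suc_atMost by (simp add: qpoch_inf_def)
    ultimately show "g x = qpoch_inf p x"
      by (rule LIMSEQ_unique)
  qed simp_all
  finally show "\<exists>d>0. cball z d \<subseteq> UNIV \<and> uniform_limit (cball z d) ?P (qpoch_inf p) sequentially"
    by (intro exI[of _ 1] conjI) simp_all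
qed (auto intro!: holomorphic_intros)

lemma Etheta_conv_qpoch_inf:
  assumes "norm p < 1"
  shows "Etheta p x = qpoch_inf p x * qpoch_inf p (p / x)"
  unfolding Etheta_def qpoch_inf_def
  using prodinf_mult[OF convergent_qpoch_inf[OF assms, of x] convergent_qpoch_inf[OF assms, of "p / x"]]
  by (simp add: mult_ac)

text \<open>The factor \<open>exp (- w / 2)\<close> makes the function odd, so that no powers of the nome or of the base
  occur in the identities below.\<close>

definition odd_theta :: "complex \<Rightarrow> complex \<Rightarrow> complex" where
  "odd_theta p w = exp (- w / 2) * Etheta p (exp w)"

lemma odd_theta_conv_qpoch_inf:
  assumes "norm p < 1"
  shows "odd_theta p w = exp (- w / 2) * qpoch_inf p (exp w) * qpoch_inf p (p * exp (- w))"
  by (simp add: odd_theta_def Etheta_conv_qpoch_inf[OF assms] exp_minus field_simps)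

text \<open>Once \<open>1 - exp w\<close> is split off, the two remaining products are exchanged
  when \<open>w\<close> changes sign. Oddness and the simple zero at 0 can be read off this
  form.\<close>

lemma odd_theta_conv_half:
  assumes "norm p < 1"
  shows "odd_theta p w = (exp (- w / 2) - exp (w / 2)) * qpoch_inf p (p * exp w) * qpoch_inf p (p * exp (- w))"
proof -
  have "exp (- w / 2) * (1 - exp w) = exp (- w / 2) - exp (w / 2)"
    by (simp add: right_diff_distrib flip: exp_add)
  then show ?thesis
    using qpoch_inf_rec[OF assms, of "exp w"] by (simp add: odd_theta_conv_qpoch_inf[OF assms])
qed

lemma odd_theta_minus:
  assumes "norm p < 1"
  shows "odd_theta p (- w) = - odd_theta p w"
  by (simp add: odd_theta_conv_half[OF assms] algebra_simps)

lemma holomorphic_odd_theta: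
  assumes "norm p < 1"
  shows "odd_theta p holomorphic_on UNIV"
proof -
  have [holomorphic_intros]: "(\<lambda>z. qpoch_inf p (f z)) holomorphic_on UNIV"
    if "f holomorphic_on UNIV" for f
    using holomorphic_on_compose_gen[OF that holomorphic_qpoch_inf[OF assms]] by (simp add: o_def)
  have "(\<lambda>w. exp (- w / 2) * qpoch_inf p (exp w) * qpoch_inf p (p * exp (- w))) holomorphic_on UNIV"
    by (intro holomorphic_intros)  auto
  moreover have "odd_theta p = (\<lambda>w. exp (- w / 2) * qpoch_inf p (exp w) * qpoch_inf p (p * exp (- w)))"
    using odd_theta_conv_qpoch_inf[OF assms] by blast
  ultimately show ?thesis by simp
qed

lemma holomorphic_odd_theta_compose [holomorphic_intros]:
  assumes "norm p < 1" "f holomorphic_on S"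
  shows "(\<lambda>z. odd_theta p (f z)) holomorphic_on S"
  using holomorphic_on_compose_gen[OF assms(2) holomorphic_odd_theta[OF assms(1)]] by (simp add: o_def)

lemma continuous_on_odd_theta [continuous_intros]:
  assumes "norm p < 1" "continuous_on S f"
  shows "continuous_on S (\<lambda>z. odd_theta p (f z))"
  using continuous_on_compose2[OF holomorphic_on_imp_continuous_on[OF holomorphic_odd_theta[OF assms(1)]] assms(2)]
  by simp

lemma tendsto_odd_theta [tendsto_intros]:
  assumes "norm p < 1" "(f \<longlongrightarrow> l) F"
  shows "((\<lambda>z. odd_theta p (f z)) \<longlongrightarrow> odd_theta p l) F"
proof -
  have "isCont (odd_theta p) l"
    using continuous_on_odd_theta[OF assms(1) continuous_on_id, of UNIV]
    by (simp add: continuous_on_eq_continuous_at)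
  then show ?thesis using assms(2) by (rule isCont_tendsto_compose)
qed

lemma odd_theta_0: "norm p < 1 \<Longrightarrow> odd_theta p 0 = 0"
  by (simp add: odd_theta_conv_half)

section \<open>Quasi-periods and zeros of the odd theta function\<close>

lemma odd_theta_add_2pi_i:
  assumes "norm p < 1"
  shows "odd_theta p (w + 2 * pi * \<i>) = - odd_theta p w"
proof -
  have "exp (- (w + 2 * pi * \<i>) / 2) = - exp (- w / 2)"
    by (simp add: add_divide_distrib exp_add exp_minus exp_diff diff_divide_distrib)
  moreover have "exp (w + 2 * pi * \<i>) = exp w" "exp (- (w + 2 * pi * \<i>)) = exp (- w)"
    by (simp_all add: exp_add exp_minus exp_diff)
  ultimately show ?thesis
    by (simp add: odd_theta_conv_qpoch_inf[OF assms])
qed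

text \<open>The shift multiplies \<open>exp w\<close> by \<open>p\<close>: the first product loses
  the factor \<open>1 - exp w\<close>, the second gains \<open>1 - exp (- w)\<close>, and the ratio
  of the two is \<open>- exp (- w)\<close>.\<close>

lemma odd_theta_add_Ln:
  assumes "norm p < 1" "p \<noteq> 0"
  shows "odd_theta p (w + Ln p) = - exp (- w - Ln p / 2) * odd_theta p w"
proof -
  have e: "exp (w + Ln p) = p * exp w" "p * exp (- (w + Ln p)) = exp (- w)"
    using assms by (simp_all add: exp_add exp_minus exp_diff field_simps)
  have a: "- (w + Ln p) / 2 + - w = - w - Ln p / 2 + - w / 2" "- (w + Ln p) / 2 = - w - Ln p / 2 + w / 2"
    by (simp_all add: field_simps)
  have b: "exp (- (w + Ln p) / 2 + - w) = exp (- w - Ln p / 2) * exp (- w / 2)"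
          "exp (- (w + Ln p) / 2) = exp (- w - Ln p / 2) * exp (w / 2)"
    by (simp only: a(1) exp_add) (subst a(2), simp only: exp_add)
  have "exp (- (w + Ln p) / 2) * (1 - exp (- w)) = exp (- (w + Ln p) / 2) - exp (- (w + Ln p) / 2 + - w)"
    by (simp only: right_diff_distrib exp_add mult_1_right)
  also have "\<dots> = - exp (- w - Ln p / 2) * (exp (- w / 2) - exp (w / 2))"
    unfolding b by (simp add: algebra_simps)
  finally have *: "exp (- (w + Ln p) / 2) * (1 - exp (- w)) = \<dots>" .
  have "odd_theta p (w + Ln p) = exp (- (w + Ln p) / 2) * qpoch_inf p (p * exp w) *
      ((1 - exp (- w)) * qpoch_inf p (p * exp (- w)))"
    using e qpoch_inf_rec[OF assms(1), of "exp (- w)"] by (simp add: odd_theta_conv_qpoch_inf[OF assms(1)])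
  also have "\<dots> = (exp (- (w + Ln p) / 2) * (1 - exp (- w))) * qpoch_inf p (p * exp w) * qpoch_inf p (p * exp (- w))"
    by (simp only: mult_ac)
  finally show ?thesis
    unfolding * by (simp only: odd_theta_conv_half[OF assms(1)] mult_ac)
qed

lemma odd_theta_eq_0E:
  assumes "norm p < 1" "odd_theta p w = 0"
  obtains m n :: int where "w = of_int m * (2 * pi * \<i>) + of_int n * Ln p"
proof -
  from assms have "qpoch_inf p (exp w) = 0 \<or> qpoch_inf p (p * exp (- w)) = 0"
    by (auto simp: odd_theta_conv_qpoch_inf)
  then obtain k where "exp w * p ^ k = 1 \<or> p * exp (- w) * p ^ k = 1"
    by (auto simp: qpoch_inf_eq_0_iff[OF assms(1)])
  then consider "exp w * p ^ k = 1" | "p * exp (- w) * p ^ k = 1" by blast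
  then show ?thesis
  proof cases
    case 1
    show ?thesis
    \<comment> \<open>For \<open>k = 0\<close> the witness \<open>0\<close> in front of
      \<open>Ln p\<close> keeps the default value \<open>Ln 0\<close> out of the argument; a zero
      nome allows no other \<open>k\<close>.\<close>
    proof (cases "k = 0")
      case True
      with 1 have "exp w = exp 0" by simp
      then obtain m where "w = 0 + (of_int (2 * m) * pi) * \<i>"
        unfolding exp_eq by blast
      then show ?thesis by (intro that[of m 0]) simp
    next
      case False
      with 1 have "p \<noteq> 0" by (auto simp: power_0_left)
      with 1 have "exp w * exp (of_nat k * Ln p) = 1"
        by (simp add: exp_of_nat_mult)
      then have "exp (w + of_nat k * Ln p) = exp 0" by (simp add: exp_add)
      then obtain m where "w + of_nat k * Ln p = 0 + (of_int (2 * m) * pi) * \<i>"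
        unfolding exp_eq by blast
      then show ?thesis by (intro that[of m "- int k"]) (simp add: algebra_simps)
    qed
  next
    case 2
    then have "p \<noteq> 0" by auto
    with 2 have "exp (- w) * exp (of_nat (Suc k) * Ln p) = 1"
      by (subst exp_of_nat_mult) (simp add: mult_ac)
    then have "exp (- w + of_nat (Suc k) * Ln p) = exp 0"
      by (metis exp_add exp_zero)
    then obtain m where "- w + of_nat (Suc k) * Ln p = 0 + (of_int (2 * m) * pi) * \<i>"
      unfolding exp_eq by blast
    then show ?thesis by (intro that[of "- m" "int (Suc k)"]) (simp add: algebra_simps)
  qed
qed

lemma countable_odd_theta_zeros:
  assumes "norm p < 1"
  shows "countable {w. odd_theta p w = 0}"
proof (rule countable_subset)
  show "{w. odd_theta p w = 0} \<subseteq> (\<lambda>(m, n). of_int m * (2 * pi * \<i>) + of_int n * Ln p) ` UNIV"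
  proof
    fix w assume "w \<in> {w. odd_theta p w = 0}"
    then obtain m n where "w = of_int m * (2 * pi * \<i>) + of_int n * Ln p"
      using odd_theta_eq_0E[OF assms] by blast
    then have "w = (\<lambda>(m, n). of_int m * (2 * pi * \<i>) + of_int n * Ln p) (m, n)" by simp
    then show "w \<in> (\<lambda>(m, n). of_int m * (2 * pi * \<i>) + of_int n * Ln p) ` UNIV" by blast
  qed
qed simp

section \<open>The Weierstrass addition formula\<close>

text \<open>The multiplier is left existential. Its shape is stable under sums and negatives of
  periods, so two generators suffice for the whole lattice.\<close>

definition quasi_period :: "(complex \<Rightarrow> complex) \<Rightarrow> complex \<Rightarrow> bool" where
  "quasi_period f l \<longleftrightarrow> (\<exists>c k. c \<noteq> 0 \<and> (\<forall>w. f (w + l) = c * exp (k * w) * f w))"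

lemma quasi_period_0: "quasi_period f 0"
  unfolding quasi_period_def by (intro exI[of _ 1] exI[of _ 0]) simp

lemma quasi_period_add:
  assumes "quasi_period f l" "quasi_period f m"
  shows "quasi_period f (l + m)"
proof -
  obtain c k where c: "c \<noteq> 0" "\<And>w. f (w + l) = c * exp (k * w) * f w"
    using assms(1) unfolding quasi_period_def by blast
  obtain d j where d: "d \<noteq> 0" "\<And>w. f (w + m) = d * exp (j * w) * f w"
    using assms(2) unfolding quasi_period_def by blast
  have "f (w + (l + m)) = c * d * exp (j * l) * exp ((k + j) * w) * f w" for w
    using d(2)[of "w + l"] c(2)[of w] by (simp add: algebra_simps exp_add)
  then show ?thesis
    unfolding quasi_period_def using c d by (intro exI[of _ "c * d * exp (j * l)"] exI[of _ "k + j"]) simp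
qed

lemma quasi_period_minus:
  assumes "quasi_period f l"
  shows "quasi_period f (- l)"
proof -
  obtain c k where c: "c \<noteq> 0" "\<And>w. f (w + l) = c * exp (k * w) * f w"
    using assms unfolding quasi_period_def by blast
  have "f (w + - l) = inverse c * exp (k * l) * exp (- k * w) * f w" for w
    using c(2)[of "w - l"] c(1) by (simp add: algebra_simps exp_diff exp_minus)
  then show ?thesis
    unfolding quasi_period_def
    using c by (intro exI[of _ "inverse c * exp (k * l)"] exI[of _ "- k"]) simp
qed

lemma quasi_period_of_int_mult:
  assumes "quasi_period f l"
  shows "quasi_period f (of_int m * l)"
proof -
  have n: "quasi_period f (of_nat n * l)" for n
  proof (induction n)
    case 0
    then show ?case by (simp add: quasi_period_0)
  next
    case (Suc n)
    then show ?case using quasi_period_add[OF assms Suc] by (simp add: algebra_simps)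
  qed
  show ?thesis
  proof (cases "m \<ge> 0")
    case True
    then show ?thesis using n[of "nat m"] by simp
  next
    case False
    then show ?thesis using quasi_period_minus[OF n[of "nat (- m)"]] by simp
  qed
qed

lemma quasi_period_odd_theta:
  assumes "norm p < 1" "p \<noteq> 0"
  shows "quasi_period (odd_theta p) (of_int m * (2 * pi * \<i>) + of_int n * Ln p)"
proof (intro quasi_period_add quasi_period_of_int_mult)
  show "quasi_period (odd_theta p) (2 * pi * \<i>)"
    unfolding quasi_period_def using odd_theta_add_2pi_i[OF assms(1)]
    by (intro exI[of _ "-1"] exI[of _ 0]) simp
  have "odd_theta p (w + Ln p) = - exp (- Ln p / 2) * exp ((-1) * w) * odd_theta p w" for w
  proof -
    have "exp (- w - Ln p / 2) = exp (- Ln p / 2) * exp ((-1) * w)"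
      by (subst exp_add[symmetric], rule arg_cong[of _ _ exp]) simp
    then show ?thesis by (simp add: odd_theta_add_Ln[OF assms])
  qed
  then show "quasi_period (odd_theta p) (Ln p)"
    unfolding quasi_period_def by (intro exI[of _ "- exp (- Ln p / 2)"] exI[of _ "-1"]) simp
qed

text \<open>At 0 the derivative is \<open>- H 0\<close>, where \<open>H 0\<close> is the square of
  the nonvanishing product of all \<open>1 - p ^ (k + 1)\<close>. Every other zero is a
  quasi-period, and the multiplier, which has no zeros, transports the statement there.\<close>

lemma deriv_odd_theta_nz:
  assumes "norm p < 1" "p \<noteq> 0" "odd_theta p z = 0"
  shows "deriv (odd_theta p) z \<noteq> 0"
proof -
  have diff: "odd_theta p field_differentiable at w" for w
    using holomorphic_odd_theta[OF assms(1)] by (simp add: holomorphic_on_imp_differentiable_at)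
  define H where "H w = qpoch_inf p (p * exp w) * qpoch_inf p (p * exp (- w))" for w
  have "H holomorphic_on UNIV"
    unfolding H_def
    by (intro holomorphic_intros holomorphic_on_compose_gen[OF _ holomorphic_qpoch_inf[OF assms(1)], unfolded o_def]) auto
  then have H: "(H has_field_derivative deriv H 0) (at 0)"
    by (simp add: holomorphic_derivI)
  have "odd_theta p = (\<lambda>w. (exp (- w / 2) - exp (w / 2)) * H w)"
    by (rule ext) (simp add: odd_theta_conv_half[OF assms(1)] H_def)
  moreover have "((\<lambda>w. (exp (- w / 2) - exp (w / 2)) * H w) has_field_derivative - H 0) (at 0)"
    by (rule derivative_eq_intros H refl | simp)+
  ultimately have d0: "deriv (odd_theta p) 0 = - H 0"
    by (simp add: DERIV_imp_deriv)
  have "p * p ^ k \<noteq> 1" for k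
  proof
    assume "p * p ^ k = 1"
    then have "norm p ^ Suc k = 1" by (metis norm_one norm_power power_Suc)
    then show False using assms(1) power_Suc_less_one[of "norm p" k] assms(2) by simp
  qed
  then have "H 0 \<noteq> 0"
    by (simp add: H_def qpoch_inf_eq_0_iff[OF assms(1)])
  obtain c k where c: "c \<noteq> 0" "\<And>w. odd_theta p (w + z) = c * exp (k * w) * odd_theta p w"
  proof -
    obtain m n where "z = of_int m * (2 * pi * \<i>) + of_int n * Ln p"
      by (rule odd_theta_eq_0E[OF assms(1,3)])
    then have "quasi_period (odd_theta p) z" using quasi_period_odd_theta[OF assms(1,2), of m n] by simp
    then show ?thesis using that unfolding quasi_period_def by blast
  qed
  have "((\<lambda>w. c * exp (k * w) * odd_theta p w) has_field_derivative c * deriv (odd_theta p) 0) (at 0)"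
    using field_differentiable_derivI[OF diff[of 0]]
    by (auto intro!: derivative_eq_intros simp: odd_theta_0[OF assms(1)])
  moreover have "((\<lambda>w. odd_theta p (w + z)) has_field_derivative deriv (odd_theta p) z) (at 0)"
    using field_differentiable_derivI[OF diff[of z]] DERIV_shift[of "odd_theta p" "deriv (odd_theta p) z" 0 z]
    by simp
  ultimately have "deriv (odd_theta p) z = c * deriv (odd_theta p) 0"
    unfolding c(2) by (rule DERIV_unique[symmetric])
  then show ?thesis using d0 \<open>H 0 \<noteq> 0\<close> c(1) by simp
qed

text \<open>A simple zero of \<open>D\<close> that is also a zero of \<open>F\<close> is a removable
  singularity of the quotient, with the ratio of the derivatives as value.\<close>

lemma entire_division:
  assumes F: "F holomorphic_on UNIV" and D: "D holomorphic_on UNIV"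
    and simple: "\<And>z. D z = 0 \<Longrightarrow> deriv D z \<noteq> 0"
    and zero: "\<And>z. D z = 0 \<Longrightarrow> F z = 0"
  shows "\<exists>g. g holomorphic_on UNIV \<and> (\<forall>z. F z = D z * g z)"
proof (intro exI conjI allI)
  define g where "g z = (if D z = 0 then deriv F z / deriv D z else F z / D z)" for z
  show "F z = D z * g z" for z
    using zero by (simp add: g_def)
  have "\<exists>S. open S \<and> a \<in> S \<and> g holomorphic_on S" for a
  proof (cases "D a = 0")
    case False
    have "open {z. D z \<noteq> 0}"
      using holomorphic_on_imp_continuous_on[OF D] by (intro open_Collect_neq) auto
    moreover have "g holomorphic_on {z. D z \<noteq> 0}"
    proof (rule holomorphic_transform)
      show "(\<lambda>z. F z / D z) holomorphic_on {z. D z \<noteq> 0}"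
        by (intro holomorphic_on_divide holomorphic_on_subset[OF F] holomorphic_on_subset[OF D]) auto
    qed (auto simp: g_def)
    ultimately show ?thesis using False by blast
  next
    case True
    \<comment> \<open>Near \<open>a\<close> the ratio of the two difference quotients is
      holomorphic, and it agrees with \<open>g\<close> because \<open>F a\<close> and
      \<open>D a\<close> are zero.\<close>
    define F1 where "F1 z = (if z = a then deriv F a else (F z - F a) / (z - a))" for z
    define D1 where "D1 z = (if z = a then deriv D a else (D z - D a) / (z - a))" for z
    have F1: "F1 holomorphic_on UNIV" and D1: "D1 holomorphic_on UNIV"
      unfolding F1_def D1_def by (rule pole_lemma_open[OF F] pole_lemma_open[OF D], simp)+
    have "open {z. D1 z \<noteq> 0}"
      using holomorphic_on_imp_continuous_on[OF D1] by (intro open_Collect_neq) auto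
    moreover have "g holomorphic_on {z. D1 z \<noteq> 0}"
    proof (rule holomorphic_transform)
      show "(\<lambda>z. F1 z / D1 z) holomorphic_on {z. D1 z \<noteq> 0}"
        by (intro holomorphic_on_divide holomorphic_on_subset[OF F1] holomorphic_on_subset[OF D1]) auto
      show "F1 z / D1 z = g z" if "z \<in> {z. D1 z \<noteq> 0}" for z
        using that True zero by (auto simp: g_def F1_def D1_def)
    qed
    moreover have "D1 a \<noteq> 0" using simple[OF True] by (simp add: D1_def)
    ultimately show ?thesis by blast
  qed
  then have "g field_differentiable at a" for a
    using holomorphic_on_imp_differentiable_at by blast
  then show "g holomorphic_on UNIV"
    by (simp add: holomorphic_on_def field_differentiable_at_within)
qed

section \<open>Identities that hold off a countable set\<close>

lemma at_within_Compl_countable_neq_bot: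
  fixes z :: complex
  assumes "countable S"
  shows "at z within - S \<noteq> bot"
proof -
  have "z islimpt - S"
    unfolding islimpt_approachable
  proof safe
    fix e :: real assume "e > 0"
    have "\<not> ball z e \<subseteq> insert z S"
    proof
      assume "ball z e \<subseteq> insert z S"
      from countable_subset[OF this] have "countable (ball z e)" using assms by simp
      then show False using uncountable_ball[OF \<open>e > 0\<close>, of z] by simp
    qed
    then obtain x where "x \<in> ball z e" "x \<notin> insert z S" by blast
    then show "\<exists>x\<in>- S. x \<noteq> z \<and> dist x z < e"
      by (intro bexI[of _ x]) (simp_all add: dist_commute)
  qed
  then show ?thesis by (simp add: trivial_limit_within)
qed

text \<open>The complement of a countable set is dense in the plane. This serves three times: at the
  zeros of a denominator, at special arguments of the addition formula, and at degenerate parameters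
  of the transformation.\<close>

lemma continuous_eq_off_countable:
  fixes f g :: "complex \<Rightarrow> complex"
  assumes "isCont f z" "isCont g z" "countable S" "\<And>x. x \<notin> S \<Longrightarrow> f x = g x"
  shows "f z = g z"
proof (rule tendsto_unique[OF at_within_Compl_countable_neq_bot[OF assms(3), of z]])
  show "(f \<longlongrightarrow> f z) (at z within - S)"
    by (rule tendsto_within_subset[OF assms(1)[unfolded isCont_def] subset_UNIV])
  have "(g \<longlongrightarrow> g z) (at z within - S)"
    by (rule tendsto_within_subset[OF assms(2)[unfolded isCont_def] subset_UNIV])
  moreover have "\<forall>\<^sub>F x in at z within - S. f x = g x"
    using assms(4) by (simp add: eventually_at_filter)
  ultimately show "(f \<longlongrightarrow> g z) (at z within - S)"
    by (simp add: tendsto_cong)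
qed

text \<open>As \<open>2 * pi * \<i>\<close> is purely imaginary, the real part alone determines the
  multiple of \<open>L\<close>; the imaginary part then determines the other multiple.\<close>

lemma lattice_representative:
  fixes L :: complex
  assumes "Re L < 0"
  obtains m n :: int where "z - (of_int m * (2 * pi * \<i>) + of_int n * L) \<in> cbox (Complex (Re L) 0) (Complex 0 (2 * pi))"
proof -
  define n where "n = \<lfloor>Re z / Re L\<rfloor>"
  define y where "y = Im z - of_int n * Im L"
  define m where "m = \<lfloor>y / (2 * pi)\<rfloor>"
  have "of_int n \<le> Re z / Re L" "Re z / Re L < of_int n + 1"
    unfolding n_def by linarith+
  then have "Re z \<le> of_int n * Re L" "Re z > (of_int n + 1) * Re L"
    using assms by (simp_all add: field_simps)
  moreover have "of_int m \<le> y / (2 * pi)" "y / (2 * pi) < of_int m + 1"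
    unfolding m_def by linarith+
  then have "of_int m * (2 * pi) \<le> y" "y < (of_int m + 1) * (2 * pi)"
    by (simp_all add: field_simps)
  ultimately show ?thesis
    by (intro that[of m n]) (auto simp: in_cbox_complex_iff y_def algebra_simps)
qed

text \<open>For the odd theta function of nome 0 this is \<open>2 cosh x - 2 cosh y\<close>.\<close>

definition bracket :: "(complex \<Rightarrow> complex) \<Rightarrow> complex \<Rightarrow> complex \<Rightarrow> complex" where
  "bracket f x y = f (x + y) * f (x - y)"

lemma bracket_swap: "norm p < 1 \<Longrightarrow> bracket (odd_theta p) x y = - bracket (odd_theta p) y x"
  using odd_theta_minus[of p "x - y"] by (simp add: bracket_def add.commute)

lemma bracket_minus_right: "bracket f x (- y) = bracket f x y"
  by (simp add: bracket_def mult.commute)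

lemma bracket_self: "norm p < 1 \<Longrightarrow> bracket (odd_theta p) x x = 0"
  by (simp add: bracket_def odd_theta_0)

text \<open>The exponents coming from \<open>y + x\<close> and \<open>y - x\<close> add up to one
  without \<open>x\<close>. That the multiplier is the same for all \<open>x\<close> makes sums of
  brackets in \<open>y\<close> comparable with a single bracket.\<close>

lemma bracket_quasi_period:
  assumes "norm p < 1" "quasi_period (odd_theta p) l"
  shows "\<exists>c k. c \<noteq> 0 \<and> (\<forall>x y. bracket (odd_theta p) x (y + l) = c * exp (k * y) * bracket (odd_theta p) x y)"
proof -
  obtain c k where c: "c \<noteq> 0" "\<And>w. odd_theta p (w + l) = c * exp (k * w) * odd_theta p w"
    using assms(2) unfolding quasi_period_def by blast
  have "bracket (odd_theta p) x (y + l) = c\<^sup>2 * exp (2 * k * y) * bracket (odd_theta p) x y" for x y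
  proof -
    have "bracket (odd_theta p) x (y + l) = - (odd_theta p ((y + x) + l) * odd_theta p ((y - x) + l))"
      using odd_theta_minus[OF assms(1), of "y - x + l"] by (simp add: bracket_def algebra_simps)
    also have "\<dots> = c\<^sup>2 * (exp (k * (y + x)) * exp (k * (y - x))) * (- (odd_theta p (y + x) * odd_theta p (y - x)))"
      unfolding c(2) by (simp add: power2_eq_square)
    also have "exp (k * (y + x)) * exp (k * (y - x)) = exp (2 * k * y)"
      by (subst exp_add[symmetric], rule arg_cong[of _ _ exp]) (simp add: algebra_simps)
    also have "- (odd_theta p (y + x) * odd_theta p (y - x)) = bracket (odd_theta p) x y"
      using odd_theta_minus[OF assms(1), of "y - x"] by (simp add: bracket_def algebra_simps)
    finally show ?thesis .
  qed
  then show ?thesis using c(1) by (intro exI[of _ "c\<^sup>2"] exI[of _ "2 * k"]) auto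
qed

text \<open>For generic \<open>z\<close>, the right-hand side and \<open>bracket (odd_theta p) z y\<close> are quasi-periodic in \<open>y\<close> with the
  same factors, and the former vanishes at the zeros \<open>\<plusminus> z\<close> (modulo the periods) of the latter, which are simple;
  so the quotient is a doubly periodic entire function.\<close>

lemma bracket_Weierstrass_generic:
  assumes p: "norm p < 1" "p \<noteq> 0" and z: "odd_theta p (2 * z) \<noteq> 0" and zw: "bracket (odd_theta p) z w \<noteq> 0"
  shows "bracket (odd_theta p) z y * bracket (odd_theta p) x w = bracket (odd_theta p) z w * bracket (odd_theta p) x y - bracket (odd_theta p) z x * bracket (odd_theta p) w y"
proof -
  define F where "F y = bracket (odd_theta p) z w * bracket (odd_theta p) x y - bracket (odd_theta p) z x * bracket (odd_theta p) w y" for y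
  define D where "D y = bracket (odd_theta p) z y" for y
  have F: "F holomorphic_on UNIV" and D: "D holomorphic_on UNIV"
    unfolding F_def D_def bracket_def by (intro holomorphic_intros p)+
  have diff: "odd_theta p field_differentiable at w" for w
    using holomorphic_odd_theta[OF p(1)] by (simp add: holomorphic_on_imp_differentiable_at)
  have period: "quasi_period (odd_theta p) l" if l: "odd_theta p l = 0" for l
  proof -
    obtain m n where "l = of_int m * (2 * pi * \<i>) + of_int n * Ln p"
      by (rule odd_theta_eq_0E[OF p(1) l])
    then show ?thesis using quasi_period_odd_theta[OF p, of m n] by simp
  qed
  have shift: "odd_theta p (u + l) = 0 \<longleftrightarrow> odd_theta p u = 0" if l: "odd_theta p l = 0" for u l
  proof -
    obtain c k where "c \<noteq> 0" "\<And>w. odd_theta p (w + l) = c * exp (k * w) * odd_theta p w"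
      using period[OF l] unfolding quasi_period_def by blast
    then show ?thesis by simp
  qed
  \<comment> \<open>Every zero of \<open>D\<close> differs from \<open>z\<close> or
    \<open>- z\<close> by a zero of the theta function, hence by a quasi-period.\<close>
  have cases: "y = - z + (z + y) \<and> odd_theta p (z + y) = 0 \<or> y = z + (y - z) \<and> odd_theta p (y - z) = 0" if "D y = 0" for y
    using that odd_theta_minus[OF p(1), of "y - z"] by (auto simp: D_def bracket_def)
  have simple: "deriv D y \<noteq> 0" if "D y = 0" for y
  proof -
    have d: "deriv D y = deriv (odd_theta p) (z + y) * odd_theta p (z - y) - odd_theta p (z + y) * deriv (odd_theta p) (z - y)"
    proof (rule DERIV_imp_deriv)
      have d1: "((\<lambda>y. odd_theta p (z + y)) has_field_derivative deriv (odd_theta p) (z + y)) (at y)"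
        using field_differentiable_derivI[OF diff, of "y + z"] DERIV_shift[of "odd_theta p" "deriv (odd_theta p) (y + z)" y z]
        by (simp add: add.commute)
      have "((\<lambda>y. z - y) has_field_derivative - 1) (at y)"
        by (rule derivative_eq_intros refl | simp)+
      from DERIV_chain2[where f = "odd_theta p" and g = "\<lambda>y. z - y", OF field_differentiable_derivI[OF diff] this]
      have d2: "((\<lambda>y. odd_theta p (z - y)) has_field_derivative deriv (odd_theta p) (z - y) * (- 1)) (at y)" .
      show "(D has_field_derivative deriv (odd_theta p) (z + y) * odd_theta p (z - y) - odd_theta p (z + y) * deriv (odd_theta p) (z - y)) (at y)"
        unfolding D_def bracket_def by (rule DERIV_cong[OF DERIV_mult[OF d1 d2]]) simp
    qed
    \<comment> \<open>Zeros of the theta function are closed under addition, so a common zero of the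
      two factors would make \<open>2 * z\<close> a zero.\<close>
    have nz: "\<not> (odd_theta p (z + y) = 0 \<and> odd_theta p (z - y) = 0)"
    proof
      assume "odd_theta p (z + y) = 0 \<and> odd_theta p (z - y) = 0"
      with shift[of "z - y" "z + y"] have "odd_theta p (z + y + (z - y)) = 0" by blast
      moreover have "z + y + (z - y) = 2 * z" by simp
      ultimately show False using z by (simp only:)
    qed
    from that have "odd_theta p (z + y) = 0 \<or> odd_theta p (z - y) = 0" by (simp add: D_def bracket_def)
    then show ?thesis
    proof
      assume "odd_theta p (z + y) = 0"
      with nz deriv_odd_theta_nz[OF p this] show ?thesis unfolding d by simp
    next
      assume "odd_theta p (z - y) = 0"
      with nz deriv_odd_theta_nz[OF p this] show ?thesis unfolding d by simp
    qed
  qed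
  have zero: "F y = 0" if "D y = 0" for y
  proof -
    \<comment> \<open>At \<open>y = z\<close> the two products cancel by antisymmetry of the
      bracket, and \<open>F\<close> is even in \<open>y\<close>.\<close>
    have Fz: "F z = 0" "F (- z) = 0"
      unfolding F_def bracket_minus_right bracket_swap[OF p(1), of x z] bracket_swap[OF p(1), of w z] by simp_all
    have F_shift: "F (u + l) = 0" if u: "F u = 0" and l: "odd_theta p l = 0" for u l
    proof -
      obtain c k where c: "\<And>x y. bracket (odd_theta p) x (y + l) = c * exp (k * y) * bracket (odd_theta p) x y"
        using bracket_quasi_period[OF p(1) period[OF l]] by auto
      have "F (u + l) = c * exp (k * u) * F u"
        unfolding F_def c by (simp add: right_diff_distrib)
      with u show ?thesis by simp
    qed
    from cases[OF that] show ?thesis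
    proof (elim disjE conjE)
      assume y: "y = - z + (z + y)" "odd_theta p (z + y) = 0"
      from F_shift[OF Fz(2) y(2)] show ?thesis by simp
    next
      assume y: "y = z + (y - z)" "odd_theta p (y - z) = 0"
      from F_shift[OF Fz(1) y(2)] show ?thesis by simp
    qed
  qed
  obtain g where g: "g holomorphic_on UNIV" "\<And>y. F y = D y * g y"
    using entire_division[OF F D simple zero] by auto
  have contg: "isCont g y" for y
    using holomorphic_on_imp_continuous_on[OF g(1)] by (simp add: continuous_on_eq_continuous_at)
  have countD: "countable {y. D y = 0}"
  proof (rule countable_subset)
    show "{y. D y = 0} \<subseteq> (\<lambda>w. w - z) ` {w. odd_theta p w = 0} \<union> (\<lambda>w. z + w) ` {w. odd_theta p w = 0}"
    proof
      fix y assume "y \<in> {y. D y = 0}"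
      then consider "odd_theta p (z + y) = 0" | "odd_theta p (y - z) = 0" using cases[of y] by auto
      then show "y \<in> (\<lambda>w. w - z) ` {w. odd_theta p w = 0} \<union> (\<lambda>w. z + w) ` {w. odd_theta p w = 0}"
      proof cases
        case 1
        then show ?thesis by (intro UnI1 image_eqI[of _ _ "z + y"]) auto
      next
        case 2
        then show ?thesis by (intro UnI2 image_eqI[of _ _ "y - z"]) auto
      qed
    qed
  qed (simp add: countable_odd_theta_zeros[OF p(1)])
  have per: "g (y + l) = g y" if l: "quasi_period (odd_theta p) l" for y l
  \<comment> \<open>Off the zeros of \<open>D\<close> the common multiplier cancels from the
    quotient; at the zeros continuity takes over.\<close>
  proof (rule continuous_eq_off_countable[where f = "\<lambda>y. g (y + l)" and g = g, OF _ contg countD])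
    show "isCont (\<lambda>y. g (y + l)) y"
      by (rule isCont_o2[where f = "\<lambda>y. y + l" and g = g]) (simp_all add: contg)
    fix y assume y: "y \<notin> {y. D y = 0}"
    obtain c k where c: "c \<noteq> 0" "\<And>x y. bracket (odd_theta p) x (y + l) = c * exp (k * y) * bracket (odd_theta p) x y"
      using bracket_quasi_period[OF p(1) l] by blast
    have "c * exp (k * y) * F y = F (y + l)"
      unfolding F_def c by (simp add: right_diff_distrib)
    also have "\<dots> = c * exp (k * y) * D y * g (y + l)"
      unfolding g(2) D_def c ..
    finally have "c * exp (k * y) * D y * g y = c * exp (k * y) * D y * g (y + l)"
      unfolding g(2) by (simp only: mult.assoc)
    then show "g (y + l) = g y" using y c(1) by simp
  qed
  have "Re (Ln p) < 0"
    using p by (simp add: Re_Ln)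
  \<comment> \<open>By periodicity all values are taken on a compact box, so Liouville's theorem
    applies.\<close>
  have "range g \<subseteq> g ` cbox (Complex (Re (Ln p)) 0) (Complex 0 (2 * pi))"
  proof
    fix v assume "v \<in> range g"
    then obtain y where y: "v = g y" by blast
    obtain m n where mn: "y - (of_int m * (2 * pi * \<i>) + of_int n * Ln p)
        \<in> cbox (Complex (Re (Ln p)) 0) (Complex 0 (2 * pi))"
      using lattice_representative[OF \<open>Re (Ln p) < 0\<close>, of y] by blast
    have "v = g (y - (of_int m * (2 * pi * \<i>) + of_int n * Ln p))"
      using per[OF quasi_period_odd_theta[OF p], of "y - (of_int m * (2 * pi * \<i>) + of_int n * Ln p)" m n] y
      by (simp add: algebra_simps)
    with mn show "v \<in> g ` cbox (Complex (Re (Ln p)) 0) (Complex 0 (2 * pi))" by blast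
  qed
  moreover have "compact (g ` cbox (Complex (Re (Ln p)) 0) (Complex 0 (2 * pi)))"
    by (intro compact_continuous_image continuous_at_imp_continuous_on) (auto simp: contg)
  ultimately have "bounded (range g)"
    using compact_imp_bounded bounded_subset by blast
  then obtain \<kappa> where \<kappa>: "\<And>y. g y = \<kappa>"
    using Liouville_theorem[OF g(1)] by (auto simp: constant_on_def)
  \<comment> \<open>The constant is found at \<open>y = w\<close>, where the subtracted product
    vanishes.\<close>
  have "F w = bracket (odd_theta p) z w * bracket (odd_theta p) x w"
    by (simp add: F_def bracket_self[OF p(1)])
  with g(2)[of w] zw have "\<kappa> = bracket (odd_theta p) x w"
    by (simp add: \<kappa> D_def)
  with g(2)[of y] show ?thesis
    by (simp add: \<kappa> D_def F_def)
qed

lemma odd_theta_0_nome: "odd_theta 0 w = exp (- w / 2) - exp (w / 2)"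
proof -
  have "qpoch_inf 0 0 = 1" by (simp add: qpoch_inf_def)
  then show ?thesis by (simp add: odd_theta_conv_half)
qed

lemma isCont_bracket_compose:
  assumes "norm p < 1" "isCont f z" "isCont g z"
  shows "isCont (\<lambda>z. bracket (odd_theta p) (f z) (g z)) z"
  using assms unfolding bracket_def isCont_def by (intro tendsto_intros) auto

text \<open>For zero nome there is no second period, but a bracket is then a difference of two
  numbers, each attached to one argument, and the formula is a polynomial identity. For other nomes,
  continuity in \<open>z\<close> removes the two nonvanishing conditions.\<close>

theorem bracket_Weierstrass:
  assumes p: "norm p < 1"
  shows "bracket (odd_theta p) z y * bracket (odd_theta p) x w = bracket (odd_theta p) z w * bracket (odd_theta p) x y - bracket (odd_theta p) z x * bracket (odd_theta p) w y"
proof (cases "p = 0")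
  case True
  have *: "bracket (odd_theta 0) u v = exp u + exp (- u) - exp v - exp (- v)" for u v
  proof -
    have "bracket (odd_theta 0) u v = exp (- (u + v) / 2 + - (u - v) / 2) - exp (- (u + v) / 2 + (u - v) / 2)
          - exp ((u + v) / 2 + - (u - v) / 2) + exp ((u + v) / 2 + (u - v) / 2)"
      unfolding bracket_def odd_theta_0_nome exp_add by (simp add: algebra_simps)
    also have "\<dots> = exp (- u) - exp (- v) - exp v + exp u"
      by (simp add: field_simps)
    finally show ?thesis by simp
  qed
  show ?thesis unfolding True * by algebra
next
  case False
  let ?S = "(\<lambda>u. u / 2) ` {u. odd_theta p u = 0} \<union> (\<lambda>u. u - w) ` {u. odd_theta p u = 0} \<union> (\<lambda>u. u + w) ` {u. odd_theta p u = 0}"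
  show ?thesis
  proof (rule continuous_eq_off_countable[where S = ?S and f = "\<lambda>z. bracket (odd_theta p) z y * bracket (odd_theta p) x w"
        and g = "\<lambda>z. bracket (odd_theta p) z w * bracket (odd_theta p) x y - bracket (odd_theta p) z x * bracket (odd_theta p) w y"])
    fix z assume z: "z \<notin> ?S"
    have "odd_theta p (2 * z) \<noteq> 0"
    proof
      assume "odd_theta p (2 * z) = 0"
      then have "z \<in> (\<lambda>u. u / 2) ` {u. odd_theta p u = 0}" by (intro image_eqI[of _ _ "2 * z"]) simp_all
      with z show False by blast
    qed
    moreover have "odd_theta p (z + w) \<noteq> 0"
    proof
      assume "odd_theta p (z + w) = 0"
      then have "z \<in> (\<lambda>u. u - w) ` {u. odd_theta p u = 0}" by (intro image_eqI[of _ _ "z + w"]) simp_all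
      with z show False by blast
    qed
    moreover have "odd_theta p (z - w) \<noteq> 0"
    proof
      assume "odd_theta p (z - w) = 0"
      then have "z \<in> (\<lambda>u. u + w) ` {u. odd_theta p u = 0}" by (intro image_eqI[of _ _ "z - w"]) simp_all
      with z show False by blast
    qed
    ultimately show "bracket (odd_theta p) z y * bracket (odd_theta p) x w = bracket (odd_theta p) z w * bracket (odd_theta p) x y - bracket (odd_theta p) z x * bracket (odd_theta p) w y"
      by (intro bracket_Weierstrass_generic p False) (simp_all add: bracket_def)
  next
    show "countable ?S" by (simp add: countable_odd_theta_zeros[OF p])
  qed (intro isCont_mult isCont_diff isCont_bracket_compose p continuous_ident continuous_const)+
qed

section \<open>Partial fractions\<close>

definition add_poch :: "(complex \<Rightarrow> complex) \<Rightarrow> complex \<Rightarrow> complex \<Rightarrow> nat \<Rightarrow> complex" where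
  "add_poch f h x n = (\<Prod>i<n. f (x + of_nat i * h))"

lemma add_poch_0 [simp]: "add_poch f h x 0 = 1"
  by (simp add: add_poch_def)

lemma add_poch_Suc: "add_poch f h x (Suc n) = add_poch f h x n * f (x + of_nat n * h)"
  by (simp add: add_poch_def)

lemma add_poch_Suc_shift: "add_poch f h x (Suc n) = f x * add_poch f h (x + h) n"
  by (induction n) (simp_all add: add_poch_Suc algebra_simps)

lemma add_poch_add: "add_poch f h x (m + n) = add_poch f h x m * add_poch f h (x + of_nat m * h) n"
  by (induction n) (simp_all add: add_poch_Suc algebra_simps)

lemma add_poch_nonzeroI: "(\<And>i. i < n \<Longrightarrow> f (x + of_nat i * h) \<noteq> 0) \<Longrightarrow> add_poch f h x n \<noteq> 0"
  by (simp add: add_poch_def)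

text \<open>The algebra below rests on these two properties alone and is thereby separated from the
  analysis. The identity and the sine satisfy them too, which gives the rational and trigonometric
  degenerations.\<close>

locale odd_Weierstrass =
  fixes s :: "complex \<Rightarrow> complex"
  assumes odd: "s (- x) = - s x"
    and Weierstrass: "bracket s z y * bracket s x w = bracket s z w * bracket s x y - bracket s z x * bracket s w y"
begin

lemma s_0: "s 0 = 0"
  using odd[of 0] by simp

lemma bracket_commute: "bracket s x y = - bracket s y x"
  using odd[of "x - y"] by (simp add: bracket_def add.commute)

text \<open>Two-point interpolation in \<open>y\<close>: setting \<open>y = w\<close> or
  \<open>y = x\<close> removes one term and determines the coefficient of the other.\<close>

lemma bracket_interpolation:
  assumes "bracket s x w \<noteq> 0"
  shows "bracket s z y = bracket s z w / bracket s x w * bracket s x y + bracket s z x / bracket s w x * bracket s w y"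
  using Weierstrass[of z y x w] assms bracket_commute[of w x] by (simp add: field_simps)

text \<open>Interpolating the new numerator between the nodes \<open>B j\<close> and
  \<open>B (Suc k)\<close> splits each old term into one with its own pole and one with the new
  pole. With one numerator factor fewer than denominator factors, no further term arises.\<close>

lemma partial_fractions:
  fixes A B :: "nat \<Rightarrow> complex"
  assumes "\<And>i j. i \<le> k \<Longrightarrow> j \<le> k \<Longrightarrow> i \<noteq> j \<Longrightarrow> bracket s (B i) (B j) \<noteq> 0"
    and "\<And>i. i \<le> k \<Longrightarrow> bracket s (B i) X \<noteq> 0"
  shows "(\<Prod>i<k. bracket s (A i) X) / (\<Prod>i\<le>k. bracket s (B i) X)
    = (\<Sum>j\<le>k. (\<Prod>i<k. bracket s (A i) (B j)) / (\<Prod>i\<in>{..k} - {j}. bracket s (B i) (B j)) / bracket s (B j) X)"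
  using assms
proof (induction k arbitrary: X)
  case 0
  then show ?case by simp
next
  case (Suc k)
  define r where "r k j = (\<Prod>i<k. bracket s (A i) (B j)) / (\<Prod>i\<in>{..k} - {j}. bracket s (B i) (B j))" for k j
  let ?w = "B (Suc k)"
  have IH: "(\<Prod>i<k. bracket s (A i) Y) / (\<Prod>i\<le>k. bracket s (B i) Y) = (\<Sum>j\<le>k. r k j / bracket s (B j) Y)"
    if "\<And>i. i \<le> k \<Longrightarrow> bracket s (B i) Y \<noteq> 0" for Y
    unfolding r_def using Suc.IH[of Y] Suc.prems(1) that by simp
  have r_Suc: "r (Suc k) j = r k j * bracket s (A k) (B j) / bracket s ?w (B j)" if "j \<le> k" for j
  proof -
    have "{..Suc k} - {j} = insert (Suc k) ({..k} - {j})" using that by auto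
    then show ?thesis by (simp add: r_def)
  qed
  have "{..Suc k} - {Suc k} = {..k}" by auto
  then have r_last: "r (Suc k) (Suc k) = (\<Prod>i<k. bracket s (A i) ?w) * bracket s (A k) ?w / (\<Prod>i\<le>k. bracket s (B i) ?w)"
    by (simp add: r_def)
  have "(\<Prod>i<Suc k. bracket s (A i) X) / (\<Prod>i\<le>Suc k. bracket s (B i) X)
      = (\<Prod>i<k. bracket s (A i) X) / (\<Prod>i\<le>k. bracket s (B i) X) * (bracket s (A k) X / bracket s ?w X)"
    by simp
  also have "\<dots> = (\<Sum>j\<le>k. r k j / bracket s (B j) X) * (bracket s (A k) X / bracket s ?w X)"
    using IH[of X] Suc.prems(2) by simp
  also have "\<dots> = (\<Sum>j\<le>k. r (Suc k) j / bracket s (B j) X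
       + r k j / bracket s (B j) ?w * bracket s (A k) ?w / bracket s ?w X)"
    unfolding sum_distrib_right
  proof (rule sum.cong)
    fix j assume "j \<in> {..k}"
    then have nz: "bracket s (B j) ?w \<noteq> 0" "bracket s ?w (B j) \<noteq> 0" "bracket s (B j) X \<noteq> 0" "bracket s ?w X \<noteq> 0"
      using Suc.prems by auto
    have "r k j / bracket s (B j) X * (bracket s (A k) X / bracket s ?w X)
      = r k j / bracket s (B j) X * ((bracket s (A k) ?w / bracket s (B j) ?w * bracket s (B j) X
          + bracket s (A k) (B j) / bracket s ?w (B j) * bracket s ?w X) / bracket s ?w X)"
      by (subst bracket_interpolation[OF nz(1), of "A k" X]) simp
    also have "\<dots> = r (Suc k) j / bracket s (B j) X + r k j / bracket s (B j) ?w * bracket s (A k) ?w / bracket s ?w X"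
      using nz \<open>j \<in> {..k}\<close> by (simp add: r_Suc field_simps)
    finally show "r k j / bracket s (B j) X * (bracket s (A k) X / bracket s ?w X) = \<dots>" .
  qed simp
  also have "\<dots> = (\<Sum>j\<le>k. r (Suc k) j / bracket s (B j) X)
      + (\<Sum>j\<le>k. r k j / bracket s (B j) ?w) * bracket s (A k) ?w / bracket s ?w X"
    by (simp add: sum.distrib sum_distrib_right sum_divide_distrib)
  \<comment> \<open>The contributions to the new pole are summed by the induction hypothesis, taken
    at the new node instead of \<open>X\<close>.\<close>
  also have "(\<Sum>j\<le>k. r k j / bracket s (B j) ?w) = (\<Prod>i<k. bracket s (A i) ?w) / (\<Prod>i\<le>k. bracket s (B i) ?w)"
    using IH[of ?w] Suc.prems(1) by simp
  also have "\<dots> * bracket s (A k) ?w / bracket s ?w X = r (Suc k) (Suc k) / bracket s ?w X"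
    by (simp add: r_last)
  finally show ?case by (simp add: r_def)
qed

lemma add_poch_reflect: "add_poch s h x n = (-1) ^ n * add_poch s h (- x - (of_nat n - 1) * h) n"
proof -
  have "add_poch s h x n = (\<Prod>i<n. - s (- x - (of_nat n - 1) * h + of_nat (n - Suc i) * h))"
    unfolding add_poch_def
  proof (rule prod.cong)
    fix i assume "i \<in> {..<n}"
    then have "- x - (of_nat n - 1) * h + of_nat (n - Suc i) * h = - (x + of_nat i * h)"
      by (simp add: of_nat_diff algebra_simps)
    then show "s (x + of_nat i * h) = - s (- x - (of_nat n - 1) * h + of_nat (n - Suc i) * h)"
      by (simp only: odd minus_minus)
  qed simp
  also have "\<dots> = (\<Prod>i<n. - s (- x - (of_nat n - 1) * h + of_nat i * h))"
    by (rule prod.nat_diff_reindex)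
  finally show ?thesis by (simp add: add_poch_def prod_uminus)
qed

end

section \<open>The quadratic summation\<close>

text \<open>Raising the base by \<open>h\<close> and the length by one loses the first factor and
  gains two at the end. Such a shift occurs in the coefficient recursion below.\<close>

lemma add_poch_shift_up:
  assumes "f x \<noteq> 0"
  shows "add_poch f h (x + h) (Suc m)
    = add_poch f h x m * f (x + of_nat m * h) * f (x + (of_nat m + 1) * h) / f x"
proof -
  have "f x * add_poch f h (x + h) (Suc m) = add_poch f h x (Suc (Suc m))"
    by (simp only: add_poch_Suc_shift[of f h x "Suc m"])
  also have "\<dots> = add_poch f h x m * f (x + of_nat m * h) * f (x + (of_nat m + 1) * h)"
    by (simp add: add_poch_Suc algebra_simps)
  finally show ?thesis using assms by (simp add: field_simps)
qed

context odd_Weierstrass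
begin

text \<open>Read off from the summation to be proved: the \<open>k\<close>-th summand without its
  factors in \<open>\<beta>\<close> and \<open>\<gamma>\<close>, divided by the part of the closed
  form that is free of \<open>\<beta>\<close> and \<open>\<gamma>\<close> (the last two
  lines).\<close>

definition quad_coeff :: "complex \<Rightarrow> nat \<Rightarrow> nat \<Rightarrow> complex \<Rightarrow> complex \<Rightarrow> complex" where
  "quad_coeff h n k \<alpha> \<delta> =
     s (\<alpha> + 3 * of_nat k * h) / s \<alpha>
     * add_poch s (2 * h) \<delta> k / add_poch s h (\<alpha> + h - \<delta>) k
     * (add_poch s h \<alpha> k * add_poch s h ((of_nat n + 1) * h) k * add_poch s h (- of_nat n * h) k)
     / (add_poch s (2 * h) (2 * h) k * add_poch s (2 * h) (\<alpha> + (1 - of_nat n) * h) k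
        * add_poch s (2 * h) (\<alpha> + (of_nat n + 2) * h) k)
     * (add_poch s (2 * h) (\<alpha> + (1 - of_nat n) * h) n * add_poch s (2 * h) (\<delta> - \<alpha> - of_nat n * h) n)
     / (add_poch s h (\<alpha> + h) n * add_poch s h (\<delta> - \<alpha>) n)"

text \<open>Quantifying over all integers makes the condition invariant under shifts of
  \<open>\<alpha>\<close> and \<open>\<delta>\<close> by multiples of \<open>h\<close>.\<close>

definition quad_generic :: "complex \<Rightarrow> complex \<Rightarrow> complex \<Rightarrow> bool" where
  "quad_generic h \<alpha> \<delta> \<longleftrightarrow>
     (\<forall>i::int. i \<noteq> 0 \<longrightarrow> s (of_int i * h) \<noteq> 0) \<and>
     (\<forall>i::int. s (\<alpha> + of_int i * h) \<noteq> 0) \<and>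
     (\<forall>i::int. s (\<alpha> - \<delta> + of_int i * h) \<noteq> 0)"

lemma quad_generic_shift:
  assumes "quad_generic h \<alpha> \<delta>"
  shows "quad_generic h (\<alpha> + of_int i * h) (\<delta> + of_int j * h)"
proof -
  have "\<alpha> + of_int i * h + of_int k * h = \<alpha> + of_int (i + k) * h"
    "\<alpha> + of_int i * h - (\<delta> + of_int j * h) + of_int k * h = \<alpha> - \<delta> + of_int (i - j + k) * h" for k
    by (simp_all add: algebra_simps)
  with assms show ?thesis unfolding quad_generic_def by presburger
qed

lemma quad_genericD:
  assumes "quad_generic h \<alpha> \<delta>"
  shows "i \<noteq> 0 \<Longrightarrow> x = of_int i * h \<Longrightarrow> s x \<noteq> 0"
    and "x = \<alpha> + of_int i * h \<Longrightarrow> s x \<noteq> 0"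
    and "x = \<alpha> - \<delta> + of_int i * h \<Longrightarrow> s x \<noteq> 0"
    and "x = \<delta> - \<alpha> + of_int i * h \<Longrightarrow> s x \<noteq> 0"
proof -
  show "i \<noteq> 0 \<Longrightarrow> x = of_int i * h \<Longrightarrow> s x \<noteq> 0" "x = \<alpha> + of_int i * h \<Longrightarrow> s x \<noteq> 0"
    "x = \<alpha> - \<delta> + of_int i * h \<Longrightarrow> s x \<noteq> 0"
    using assms by (auto simp: quad_generic_def)
  assume "x = \<delta> - \<alpha> + of_int i * h"
  then have "x = - (\<alpha> - \<delta> + of_int (- i) * h)" by simp
  moreover have "s (\<alpha> - \<delta> + of_int (- i) * h) \<noteq> 0"
    using assms unfolding quad_generic_def by blast
  ultimately show "s x \<noteq> 0" by (simp only: odd) simp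
qed

lemma add_poch_quad_generic:
  assumes "quad_generic h \<alpha> \<delta>"
  shows "x = \<alpha> + of_int i * h \<Longrightarrow> y = of_int j * h \<Longrightarrow> add_poch s y x n \<noteq> 0"
    and "x = \<delta> - \<alpha> + of_int i * h \<Longrightarrow> y = of_int j * h \<Longrightarrow> add_poch s y x n \<noteq> 0"
proof -
  show "add_poch s y x n \<noteq> 0" if "x = \<alpha> + of_int i * h" "y = of_int j * h"
  proof (rule add_poch_nonzeroI)
    fix k :: nat
    show "s (x + of_nat k * y) \<noteq> 0"
      by (rule quad_genericD(2)[OF assms, of _ "i + int k * j"]) (simp add: that algebra_simps)
  qed
  show "add_poch s y x n \<noteq> 0" if "x = \<delta> - \<alpha> + of_int i * h" "y = of_int j * h"
  proof (rule add_poch_nonzeroI)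
    fix k :: nat
    show "s (x + of_nat k * y) \<noteq> 0"
      by (rule quad_genericD(4)[OF assms, of _ "i + int k * j"]) (simp add: that algebra_simps)
  qed
qed

text \<open>The left edge of the Pascal triangle, where only one neighbour contributes.\<close>

lemma quad_coeff_Suc_0:
  assumes g: "quad_generic h \<alpha> \<delta>"
  shows "quad_coeff h (Suc n) 0 \<alpha> \<delta>
    = s (\<alpha> - of_nat n * h) * s (\<delta> - \<alpha> - (of_nat n + 1) * h) / (s (\<alpha> + h) * s (\<delta> - \<alpha>))
      * quad_coeff h n 0 (\<alpha> + h) (\<delta> + 2 * h)"
proof -
  have nz: "s \<alpha> \<noteq> 0" "s (\<alpha> + h) \<noteq> 0"
    by (rule quad_genericD(2)[OF g, of _ 0] quad_genericD(2)[OF g, of _ 1], simp)+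
  have e: "add_poch s (2 * h) (\<alpha> + (1 - of_nat (Suc n)) * h) (Suc n)
        = s (\<alpha> - of_nat n * h) * add_poch s (2 * h) (\<alpha> + h + (1 - of_nat n) * h) n"
     "add_poch s (2 * h) (\<delta> - \<alpha> - of_nat (Suc n) * h) (Suc n)
        = s (\<delta> - \<alpha> - (of_nat n + 1) * h) * add_poch s (2 * h) (\<delta> + 2 * h - (\<alpha> + h) - of_nat n * h) n"
     "add_poch s h (\<alpha> + h) (Suc n) = s (\<alpha> + h) * add_poch s h (\<alpha> + h + h) n"
     "add_poch s h (\<delta> - \<alpha>) (Suc n) = s (\<delta> - \<alpha>) * add_poch s h (\<delta> + 2 * h - (\<alpha> + h)) n"
    unfolding add_poch_Suc_shift by (simp_all add: algebra_simps)
  show ?thesis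
    unfolding quad_coeff_def e using nz by (simp add: ac_simps)
qed

text \<open>All three coefficients are short multiples of \<open>core\<close>, and after
  cancellation only the addition formula remains. The shifts to \<open>\<alpha> + h\<close> and
  \<open>\<delta> + 2 * h\<close> express the passage from \<open>u\<close> to \<open>u + h\<close>
  when \<open>\<alpha> = t + u\<close> and \<open>\<delta> = 2 * u + h\<close>.\<close>

lemma quad_coeff_rec:
  fixes n m :: nat
  assumes g: "quad_generic h \<alpha> \<delta>"
  defines "N \<equiv> of_nat n" and "M \<equiv> of_nat m"
  shows "quad_coeff h (Suc n) (Suc m) \<alpha> \<delta>
    = s (\<delta> + (M - N) * h) * s (- (N + M + 1) * h) / (s (\<alpha> + (3 * M + 1) * h) * s (\<alpha> - \<delta> + M * h))
        * quad_coeff h n m (\<alpha> + h) (\<delta> + 2 * h)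
      + s (\<alpha> + (2 * M + 2 - N) * h) * s (\<delta> - \<alpha> - (N + 2 * M + 3) * h)
          / (s (\<alpha> + (3 * M + 4) * h) * s (\<delta> - \<alpha> - (M + 1) * h))
        * quad_coeff h n (Suc m) (\<alpha> + h) (\<delta> + 2 * h)"
proof -
  note gD = quad_genericD[OF g]
  have nz0: "s (\<alpha>) \<noteq> 0"
    by (rule gD(2)[of _ "0"]) (simp_all add: N_def M_def)
  have nz1: "s (\<alpha> + h) \<noteq> 0"
    by (rule gD(2)[of _ "1"]) (simp_all add: N_def M_def)
  have nz2: "s (\<alpha> - N * h) \<noteq> 0"
    by (rule gD(2)[of _ "- int n"]) (simp_all add: N_def M_def)
  have nz3: "s (\<alpha> - \<delta>) \<noteq> 0"
    by (rule gD(3)[of _ "0"]) (simp_all add: N_def M_def)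
  have nz4: "s (\<alpha> + (3 * M + 1) * h) \<noteq> 0"
    by (rule gD(2)[of _ "3 * int m + 1"]) (simp_all add: N_def M_def)
  have nz5: "s (\<alpha> + (3 * M + 4) * h) \<noteq> 0"
    by (rule gD(2)[of _ "3 * int m + 4"]) (simp_all add: N_def M_def)
  have nz6: "s (\<alpha> - \<delta> + M * h) \<noteq> 0"
    by (rule gD(3)[of _ "int m"]) (simp_all add: N_def M_def)
  have nz7: "s (\<alpha> - \<delta> + (M + 1) * h) \<noteq> 0"
    by (rule gD(3)[of _ "int m + 1"]) (simp_all add: N_def M_def)
  have nz8: "s ((N + 1) * h) \<noteq> 0"
    by (rule gD(1)[of "int n + 1"]) (simp_all add: N_def M_def)
  have nz9: "s ((2 * M + 2) * h) \<noteq> 0"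
    by (rule gD(1)[of "2 * int m + 2"]) (simp_all add: N_def M_def)
  have nz10: "s (\<alpha> + (N + 3 + 2 * M) * h) \<noteq> 0"
    by (rule gD(2)[of _ "int n + 3 + 2 * int m"]) (simp_all add: N_def M_def)
  have nz11: "s (\<alpha> + (2 - N + 2 * M) * h) \<noteq> 0"
    by (rule gD(2)[of _ "2 - int n + 2 * int m"]) (simp_all add: N_def M_def)
  note nz = nz0 nz1 nz2 nz3 nz4 nz5 nz6 nz7 nz8 nz9 nz10 nz11
  define core where "core = quad_coeff h n m (\<alpha> + h) (\<delta> + 2 * h)"
  \<comment> \<open>\<open>\<rho>\<close> is the ratio of two neighbours in the old row,
    \<open>\<tau>\<close> that of the new coefficient to \<open>core\<close>.\<close>
  define \<rho> where "\<rho> = s (\<alpha> + (3 * M + 4) * h) / s (\<alpha> + (3 * M + 1) * h)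
      * (s (\<delta> + (2 * M + 2) * h) / s (\<alpha> - \<delta> + M * h))
      * (s (\<alpha> + (M + 1) * h) * s ((N + 1 + M) * h) * s ((M - N) * h)
        / (s ((2 * M + 2) * h) * s (\<alpha> + (2 - N + 2 * M) * h) * s (\<alpha> + (N + 3 + 2 * M) * h)))"
  define \<tau> where "\<tau> = s (\<alpha> + (3 * M + 3) * h) * s \<delta> * s ((N + 1 + M) * h) * s ((N + 2 + M) * h) * s (\<delta> - \<alpha> - (N + 1) * h)
      / (s (\<alpha> + (3 * M + 1) * h) * s (\<alpha> - \<delta> + M * h) * s (\<alpha> - \<delta> + (M + 1) * h)
        * s ((2 * M + 2) * h) * s (\<alpha> + (N + 3 + 2 * M) * h))"
  have e0: "s (\<alpha> + h + 3 * of_nat m * h) = s (\<alpha> + (3 * M + 1) * h)"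
    by (simp add: M_def algebra_simps)
  have R: "quad_coeff h n (Suc m) (\<alpha> + h) (\<delta> + 2 * h) = core * \<rho>"
  proof -
    have e: "s (\<alpha> + h + 3 * of_nat (Suc m) * h) = s (\<alpha> + (3 * M + 4) * h)"
      "s (\<delta> + 2 * h + of_nat m * (2 * h)) = s (\<delta> + (2 * M + 2) * h)"
      "s (\<alpha> + h + h - (\<delta> + 2 * h) + of_nat m * h) = s (\<alpha> - \<delta> + M * h)"
      "s (\<alpha> + h + of_nat m * h) = s (\<alpha> + (M + 1) * h)"
      "s ((of_nat n + 1) * h + of_nat m * h) = s ((N + 1 + M) * h)"
      "s (- of_nat n * h + of_nat m * h) = s ((M - N) * h)"
      "s (2 * h + of_nat m * (2 * h)) = s ((2 * M + 2) * h)"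
      "s (\<alpha> + h + (1 - of_nat n) * h + of_nat m * (2 * h)) = s (\<alpha> + (2 - N + 2 * M) * h)"
      "s (\<alpha> + h + (of_nat n + 2) * h + of_nat m * (2 * h)) = s (\<alpha> + (N + 3 + 2 * M) * h)"
      by (simp_all add: M_def N_def algebra_simps)
    show ?thesis
      unfolding core_def \<rho>_def quad_coeff_def add_poch_Suc e e0 using nz by (simp add: ac_simps)
  qed
  have T: "quad_coeff h (Suc n) (Suc m) \<alpha> \<delta> = core * \<tau>"
  proof -
    have e1: "add_poch s (2 * h) \<delta> (Suc m) = s \<delta> * add_poch s (2 * h) (\<delta> + 2 * h) m"
      "add_poch s h \<alpha> (Suc m) = s \<alpha> * add_poch s h (\<alpha> + h) m"
      "add_poch s h (- of_nat (Suc n) * h) (Suc m) = s (- (N + 1) * h) * add_poch s h (- of_nat n * h) m"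
      "add_poch s (2 * h) (\<alpha> + (1 - of_nat (Suc n)) * h) (Suc m)
        = s (\<alpha> - N * h) * add_poch s (2 * h) (\<alpha> + h + (1 - of_nat n) * h) m"
      "add_poch s (2 * h) (\<alpha> + (1 - of_nat (Suc n)) * h) (Suc n)
        = s (\<alpha> - N * h) * add_poch s (2 * h) (\<alpha> + h + (1 - of_nat n) * h) n"
      "add_poch s (2 * h) (\<delta> - \<alpha> - of_nat (Suc n) * h) (Suc n)
        = s (\<delta> - \<alpha> - (N + 1) * h) * add_poch s (2 * h) (\<delta> + 2 * h - (\<alpha> + h) - of_nat n * h) n"
      "add_poch s h (\<alpha> + h) (Suc n) = s (\<alpha> + h) * add_poch s h (\<alpha> + h + h) n"
      "add_poch s h (\<delta> - \<alpha>) (Suc n) = s (\<delta> - \<alpha>) * add_poch s h (\<delta> + 2 * h - (\<alpha> + h)) n"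
      unfolding add_poch_Suc_shift by (simp_all add: N_def algebra_simps)
    have e2: "add_poch s (2 * h) (2 * h) (Suc m) = add_poch s (2 * h) (2 * h) m * s ((2 * M + 2) * h)"
      "add_poch s (2 * h) (\<alpha> + (of_nat (Suc n) + 2) * h) (Suc m)
        = add_poch s (2 * h) (\<alpha> + h + (of_nat n + 2) * h) m * s (\<alpha> + (N + 3 + 2 * M) * h)"
      unfolding add_poch_Suc by (simp_all add: N_def M_def algebra_simps)
    have a: "\<alpha> + h - \<delta> = \<alpha> - \<delta> + h" "\<alpha> + h + h - (\<delta> + 2 * h) = \<alpha> - \<delta>"
      "(of_nat (Suc n) + 1) * h = (N + 1) * h + h" "(N + 1) * h + of_nat m * h = (N + 1 + M) * h"
      "(N + 1) * h + (of_nat m + 1) * h = (N + 2 + M) * h"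
      by (simp_all add: N_def M_def algebra_simps)
    have e3: "add_poch s h (\<alpha> + h - \<delta>) (Suc m) = add_poch s h (\<alpha> + h + h - (\<delta> + 2 * h)) m
          * s (\<alpha> - \<delta> + M * h) * s (\<alpha> - \<delta> + (M + 1) * h) / s (\<alpha> - \<delta>)"
      unfolding a(1,2) M_def by (rule add_poch_shift_up) (rule nz3)
    have "add_poch s h ((of_nat (Suc n) + 1) * h) (Suc m) = add_poch s h ((N + 1) * h) m
          * s ((N + 1 + M) * h) * s ((N + 2 + M) * h) / s ((N + 1) * h)"
      unfolding a(3) by (subst add_poch_shift_up[where f = s and x = "(N + 1) * h", OF nz8]) (simp only: a(4,5))
    then have e3': "add_poch s h ((of_nat (Suc n) + 1) * h) (Suc m) = add_poch s h ((of_nat n + 1) * h) m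
          * s ((N + 1 + M) * h) * s ((N + 2 + M) * h) / s ((N + 1) * h)"
      by (simp only: N_def)
    have e4: "s (\<delta> - \<alpha>) = - s (\<alpha> - \<delta>)" "s (- (N + 1) * h) = - s ((N + 1) * h)"
      "s (\<alpha> + 3 * of_nat (Suc m) * h) = s (\<alpha> + (3 * M + 3) * h)"
      using odd[of "\<alpha> - \<delta>"] odd[of "(N + 1) * h"] by (simp_all add: M_def algebra_simps)
    show ?thesis
      unfolding core_def \<tau>_def quad_coeff_def e1 e2 e3 e3' e4 e0 using nz by (simp add: ac_simps)
  qed
  have W: "s (\<alpha> + (3 * M + 3) * h) * s ((N + 2 + M) * h) * (s \<delta> * s (\<delta> - \<alpha> - (N + 1) * h))
     = s (\<alpha> + (N + 3 + 2 * M) * h) * s ((2 * M + 2) * h) * (s (\<delta> + (M - N) * h) * s (\<delta> - \<alpha> - (M + 1) * h))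
       - s (\<delta> + (2 * M + 2) * h) * s (\<alpha> - \<delta> + (N + 2 * M + 3) * h) * (s (\<alpha> + (M + 1) * h) * s ((N - M) * h))"
  proof -
    \<comment> \<open>Half sums and half differences of the arguments on the left of
      \<open>W\<close>; the other eight arguments then come out as listed in
      \<open>e\<close>.\<close>
    define z y x w where "z = (\<alpha> + (4 * M + N + 5) * h) / 2" and "y = (\<alpha> + (2 * M + 1 - N) * h) / 2"
      and "x = (2 * \<delta> - \<alpha> - (N + 1) * h) / 2" and "w = (\<alpha> + (N + 1) * h) / 2"
    have e: "z + y = \<alpha> + (3 * M + 3) * h" "z - y = (N + 2 + M) * h"
      "x + w = \<delta>" "x - w = \<delta> - \<alpha> - (N + 1) * h"
      "z + w = \<alpha> + (N + 3 + 2 * M) * h" "z - w = (2 * M + 2) * h"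
      "x + y = \<delta> + (M - N) * h" "x - y = \<delta> - \<alpha> - (M + 1) * h"
      "z + x = \<delta> + (2 * M + 2) * h" "z - x = \<alpha> - \<delta> + (N + 2 * M + 3) * h"
      "w + y = \<alpha> + (M + 1) * h" "w - y = (N - M) * h"
      unfolding z_def y_def x_def w_def by (simp_all add: field_simps)
    show ?thesis
      using Weierstrass[of z y x w] unfolding bracket_def e .
  qed
  have o: "s (- (N + M + 1) * h) = - s ((N + 1 + M) * h)"
      "s (\<delta> - \<alpha> - (N + 2 * M + 3) * h) = - s (\<alpha> - \<delta> + (N + 2 * M + 3) * h)"
      "s (\<delta> - \<alpha> - (M + 1) * h) = - s (\<alpha> - \<delta> + (M + 1) * h)"
      "s ((M - N) * h) = - s ((N - M) * h)"
      "s (\<alpha> + (2 * M + 2 - N) * h) = s (\<alpha> + (2 - N + 2 * M) * h)"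
    unfolding odd[symmetric] by (simp_all add: algebra_simps)
  have "\<tau> = s ((N + 1 + M) * h)
      * (s (\<alpha> + (3 * M + 3) * h) * s ((N + 2 + M) * h) * (s \<delta> * s (\<delta> - \<alpha> - (N + 1) * h)))
      / (s (\<alpha> + (3 * M + 1) * h) * s (\<alpha> - \<delta> + M * h) * s (\<alpha> - \<delta> + (M + 1) * h)
        * s ((2 * M + 2) * h) * s (\<alpha> + (N + 3 + 2 * M) * h))"
    by (simp add: \<tau>_def mult_ac)
  also have "\<dots> = s (\<delta> + (M - N) * h) * s (- (N + M + 1) * h) / (s (\<alpha> + (3 * M + 1) * h) * s (\<alpha> - \<delta> + M * h))
      + s (\<alpha> + (2 * M + 2 - N) * h) * s (\<delta> - \<alpha> - (N + 2 * M + 3) * h)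
          / (s (\<alpha> + (3 * M + 4) * h) * s (\<delta> - \<alpha> - (M + 1) * h)) * \<rho>"
    unfolding W \<rho>_def o using nz by (simp add: divide_simps) (simp add: algebra_simps)
  finally have "core * \<tau> = core * \<dots>" by simp
  then show ?thesis
    unfolding R T by (simp add: core_def algebra_simps)
qed

text \<open>A factor \<open>s 0\<close> occurs; this is the right edge of the Pascal
  triangle.\<close>

lemma quad_coeff_eq_0: "quad_coeff h n (Suc n) \<alpha> \<delta> = 0"
proof -
  have "add_poch s h (- of_nat n * h) (Suc n) = 0"
    by (simp add: add_poch_Suc s_0)
  then show ?thesis by (simp add: quad_coeff_def)
qed

text \<open>Passing from \<open>n\<close> to \<open>n + 1\<close>
  (with \<open>u\<close> replaced by \<open>u + h\<close>) adds one factor on the left, which is interpolated at the two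
  nodes that extend the basis element on either side.\<close>

lemma quad_newton:
  assumes "quad_generic h (t + u) (2 * u + h)"
  shows "(\<Prod>i<n. bracket s (u + (1 - of_nat n + 2 * of_nat i) * h) Y)
    = (\<Sum>k\<le>n. quad_coeff h n k (t + u) (2 * u + h)
        * ((\<Prod>i<k. bracket s (t + 2 * of_nat i * h) Y) * (\<Prod>i=Suc k..n. bracket s (u + of_nat i * h) Y)))"
  using assms
proof (induction n arbitrary: u)
  case 0
  have "s (t + u) \<noteq> 0" by (rule quad_genericD(2)[OF 0, of _ 0]) simp
  then show ?case by (simp add: quad_coeff_def)
next
  case (Suc n)
  define \<alpha> where "\<alpha> = t + u"
  define \<delta> where "\<delta> = 2 * u + h"
  have g: "quad_generic h \<alpha> \<delta>" using Suc.prems by (simp add: \<alpha>_def \<delta>_def)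
  define G where "G k = (\<Prod>i<k. bracket s (t + 2 * of_nat i * h) Y) * (\<Prod>i=Suc k..Suc n. bracket s (u + of_nat i * h) Y)" for k
  define S where "S k = quad_coeff h n k (\<alpha> + h) (\<delta> + 2 * h)" for k
  define U where "U k = s (\<delta> + (of_nat k - of_nat n) * h) * s (- (of_nat n + of_nat k + 1) * h)
     / (s (\<alpha> + (3 * of_nat k + 1) * h) * s (\<alpha> - \<delta> + of_nat k * h))" for k
  define V where "V k = s (\<alpha> + (2 * of_nat k - of_nat n) * h) * s (\<delta> - \<alpha> - (of_nat n + 2 * of_nat k + 1) * h)
     / (s (\<alpha> + (3 * of_nat k + 1) * h) * s (\<delta> - \<alpha> - of_nat k * h))" for k
  \<comment> \<open>In the basis element for \<open>u + h\<close>, the first bracket prolongs the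
    left product at its end, the second prolongs the right product at its beginning.\<close>
  have step: "bracket s (u - of_nat n * h) Y
      = U k * bracket s (t + 2 * of_nat k * h) Y + V k * bracket s (u + of_nat (Suc k) * h) Y" for k
  proof -
    have nz: "s (\<alpha> + (3 * of_nat k + 1) * h) \<noteq> 0"
      by (rule quad_genericD(2)[OF g, of _ "3 * int k + 1"]) simp
    have nz': "s (\<alpha> - \<delta> + of_nat k * h) \<noteq> 0"
      by (rule quad_genericD(3)[OF g, of _ "int k"]) simp
    have e: "bracket s (t + 2 * of_nat k * h) (u + of_nat (Suc k) * h)
         = s (\<alpha> + (3 * of_nat k + 1) * h) * s (\<alpha> - \<delta> + of_nat k * h)"
      "bracket s (u + of_nat (Suc k) * h) (t + 2 * of_nat k * h)
         = s (\<alpha> + (3 * of_nat k + 1) * h) * s (\<delta> - \<alpha> - of_nat k * h)"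
      "bracket s (u - of_nat n * h) (u + of_nat (Suc k) * h)
         = s (\<delta> + (of_nat k - of_nat n) * h) * s (- (of_nat n + of_nat k + 1) * h)"
      "bracket s (u - of_nat n * h) (t + 2 * of_nat k * h)
         = s (\<alpha> + (2 * of_nat k - of_nat n) * h) * s (\<delta> - \<alpha> - (of_nat n + 2 * of_nat k + 1) * h)"
      unfolding bracket_def \<alpha>_def \<delta>_def by (simp_all add: algebra_simps)
    have "bracket s (t + 2 * of_nat k * h) (u + of_nat (Suc k) * h) \<noteq> 0"
      unfolding e using nz nz' by simp
    from bracket_interpolation[OF this, of "u - of_nat n * h" Y] show ?thesis
      unfolding e U_def V_def .
  qed
  have "(\<Prod>i<Suc n. bracket s (u + (1 - of_nat (Suc n) + 2 * of_nat i) * h) Y)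
     = bracket s (u - of_nat n * h) Y * (\<Prod>i<n. bracket s (u + h + (1 - of_nat n + 2 * of_nat i) * h) Y)"
    by (subst prod.lessThan_Suc_shift) (simp add: algebra_simps)
  also have "(\<Prod>i<n. bracket s (u + h + (1 - of_nat n + 2 * of_nat i) * h) Y)
     = (\<Sum>k\<le>n. S k * ((\<Prod>i<k. bracket s (t + 2 * of_nat i * h) Y)
          * (\<Prod>i=Suc k..n. bracket s (u + h + of_nat i * h) Y)))"
  proof -
    have e: "t + (u + h) = \<alpha> + h" "2 * (u + h) + h = \<delta> + 2 * h"
      by (simp_all add: \<alpha>_def \<delta>_def)
    have "quad_generic h (t + (u + h)) (2 * (u + h) + h)"
      using quad_generic_shift[OF g, of 1 2] unfolding e by simp
    from Suc.IH[OF this] show ?thesis unfolding S_def e .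
  qed
  also have "bracket s (u - of_nat n * h) Y * \<dots> = (\<Sum>k\<le>n. U k * S k * G (Suc k) + V k * S k * G k)"
    unfolding sum_distrib_left
  proof (rule sum.cong)
    fix k assume "k \<in> {..n}"
    then have k: "k \<le> n" by simp
    have e: "(\<Prod>i=Suc k..n. bracket s (u + h + of_nat i * h) Y) = (\<Prod>i=Suc (Suc k)..Suc n. bracket s (u + of_nat i * h) Y)"
      by (subst prod.shift_bounds_cl_Suc_ivl) (simp add: algebra_simps)
    have "{Suc k..Suc n} = insert (Suc k) {Suc (Suc k)..Suc n}" using k by auto
    then have G: "G k = (\<Prod>i<k. bracket s (t + 2 * of_nat i * h) Y)
        * (bracket s (u + of_nat (Suc k) * h) Y * (\<Prod>i=Suc (Suc k)..Suc n. bracket s (u + of_nat i * h) Y))"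
      unfolding G_def by simp
    show "bracket s (u - of_nat n * h) Y * (S k * ((\<Prod>i<k. bracket s (t + 2 * of_nat i * h) Y)
          * (\<Prod>i=Suc k..n. bracket s (u + h + of_nat i * h) Y)))
        = U k * S k * G (Suc k) + V k * S k * G k"
      unfolding e G step[of k] unfolding G_def prod.lessThan_Suc by (simp only: distrib_right distrib_left mult_ac)
  qed simp
  \<comment> \<open>The added term \<open>k = Suc n\<close> is zero; with it both sums line up after
    an index shift.\<close>
  also have "\<dots> = (\<Sum>k\<le>n. U k * S k * G (Suc k)) + (\<Sum>k\<le>Suc n. V k * S k * G k)"
    by (simp add: sum.distrib S_def quad_coeff_eq_0)
  also have "\<dots> = V 0 * S 0 * G 0 + (\<Sum>k\<le>n. (U k * S k + V (Suc k) * S (Suc k)) * G (Suc k))"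
    by (subst sum.atMost_Suc_shift) (simp add: sum.distrib distrib_right)
  also have "V 0 * S 0 = quad_coeff h (Suc n) 0 \<alpha> \<delta>"
    unfolding quad_coeff_Suc_0[OF g] S_def V_def by simp
  also have "(\<Sum>k\<le>n. (U k * S k + V (Suc k) * S (Suc k)) * G (Suc k))
      = (\<Sum>k\<le>n. quad_coeff h (Suc n) (Suc k) \<alpha> \<delta> * G (Suc k))"
  proof (rule sum.cong)
    fix k
    have V: "V (Suc k) = s (\<alpha> + (2 * of_nat k + 2 - of_nat n) * h) * s (\<delta> - \<alpha> - (of_nat n + 2 * of_nat k + 3) * h)
          / (s (\<alpha> + (3 * of_nat k + 4) * h) * s (\<delta> - \<alpha> - (of_nat k + 1) * h))"
      unfolding V_def by (simp add: algebra_simps)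
    show "(U k * S k + V (Suc k) * S (Suc k)) * G (Suc k) = quad_coeff h (Suc n) (Suc k) \<alpha> \<delta> * G (Suc k)"
      unfolding quad_coeff_rec[OF g] V by (simp only: U_def S_def)
  qed simp
  also have "quad_coeff h (Suc n) 0 \<alpha> \<delta> * G 0 + \<dots> = (\<Sum>k\<le>Suc n. quad_coeff h (Suc n) k \<alpha> \<delta> * G k)"
    by (subst sum.atMost_Suc_shift) simp
  finally show ?case by (simp only: \<alpha>_def \<delta>_def G_def)
qed

text \<open>With \<open>\<beta> = t + Y\<close> and \<open>\<gamma> = t - Y\<close>, paired factors
  become brackets in \<open>Y\<close>, and the balancing condition turns into
  \<open>\<delta> = 2 * u + h\<close>. The Newton expansion is then divided by its right-hand
  product of full length and by \<open>K\<close>. This is the transformation at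
  \<open>\<epsilon> = \<alpha>\<close>, where \<open>\<phi> = (n + 1) * h\<close>.\<close>

theorem quadratic_summation:
  assumes g: "quad_generic h \<alpha> \<delta>" and \<delta>: "\<beta> + \<gamma> + \<delta> = 2 * \<alpha> + h"
    and nz: "add_poch s h (\<alpha> + h - \<beta>) n \<noteq> 0" "add_poch s h (\<alpha> + h - \<gamma>) n \<noteq> 0"
  shows "(\<Sum>k\<le>n. s (\<alpha> + 3 * of_nat k * h) / s \<alpha>
      * (add_poch s (2 * h) \<beta> k * add_poch s (2 * h) \<gamma> k * add_poch s (2 * h) \<delta> k)
      / (add_poch s h (\<alpha> + h - \<beta>) k * add_poch s h (\<alpha> + h - \<gamma>) k * add_poch s h (\<alpha> + h - \<delta>) k)
      * (add_poch s h \<alpha> k * add_poch s h ((of_nat n + 1) * h) k * add_poch s h (- of_nat n * h) k)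
      / (add_poch s (2 * h) (2 * h) k * add_poch s (2 * h) (\<alpha> + (1 - of_nat n) * h) k
        * add_poch s (2 * h) (\<alpha> + (of_nat n + 2) * h) k))
    = add_poch s h (\<alpha> + h) n * add_poch s h (\<delta> - \<alpha>) n
      * (add_poch s (2 * h) (\<alpha> + (1 - of_nat n) * h - \<beta>) n * add_poch s (2 * h) (\<alpha> + (1 - of_nat n) * h - \<gamma>) n)
      / (add_poch s h (\<alpha> + h - \<beta>) n * add_poch s h (\<alpha> + h - \<gamma>) n
        * (add_poch s (2 * h) (\<alpha> + (1 - of_nat n) * h) n * add_poch s (2 * h) (\<delta> - \<alpha> - of_nat n * h) n))"
    (is "(\<Sum>k\<le>n. ?L k) = ?R")
proof -
  define t where "t = (\<beta> + \<gamma>) / 2"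
  define Y where "Y = (\<beta> - \<gamma>) / 2"
  define u where "u = \<alpha> - t"
  define K where "K = add_poch s (2 * h) (\<alpha> + (1 - of_nat n) * h) n * add_poch s (2 * h) (\<delta> - \<alpha> - of_nat n * h) n
     / (add_poch s h (\<alpha> + h) n * add_poch s h (\<delta> - \<alpha>) n)"
  have tu: "t + u = \<alpha>" "2 * u + h = \<delta>"
  proof -
    show "t + u = \<alpha>" by (simp add: u_def)
    have "2 * u + h = 2 * \<alpha> + h - (\<beta> + \<gamma>)" by (simp add: u_def t_def field_simps)
    then show "2 * u + h = \<delta>" unfolding \<delta>[symmetric] by simp
  qed
  have K: "K \<noteq> 0"
  proof -
    have "add_poch s (2 * h) (\<alpha> + (1 - of_nat n) * h) n \<noteq> 0"
      by (rule add_poch_quad_generic(1)[OF g, of _ "1 - int n" _ 2]) simp_all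
    moreover have "add_poch s (2 * h) (\<delta> - \<alpha> - of_nat n * h) n \<noteq> 0"
      by (rule add_poch_quad_generic(2)[OF g, of _ "- int n" _ 2]) simp_all
    moreover have "add_poch s h (\<alpha> + h) n \<noteq> 0"
      by (rule add_poch_quad_generic(1)[OF g, of _ 1 _ 1]) simp_all
    moreover have "add_poch s h (\<delta> - \<alpha>) n \<noteq> 0"
      by (rule add_poch_quad_generic(2)[OF g, of _ 0 _ 1]) simp_all
    ultimately show ?thesis by (simp add: K_def)
  qed
  have e: "t + 2 * of_nat i * h + Y = \<beta> + of_nat i * (2 * h)" "t + 2 * of_nat i * h - Y = \<gamma> + of_nat i * (2 * h)"
      "u + of_nat (Suc i) * h + Y = \<alpha> + h - \<gamma> + of_nat i * h" "u + of_nat (Suc i) * h - Y = \<alpha> + h - \<beta> + of_nat i * h"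
      "u + (1 - of_nat n + 2 * of_nat i) * h + Y = \<alpha> + (1 - of_nat n) * h - \<gamma> + of_nat i * (2 * h)"
      "u + (1 - of_nat n + 2 * of_nat i) * h - Y = \<alpha> + (1 - of_nat n) * h - \<beta> + of_nat i * (2 * h)" for i
    by (simp_all add: t_def u_def Y_def field_simps)
  have P: "(\<Prod>i<k. bracket s (t + 2 * of_nat i * h) Y) = add_poch s (2 * h) \<beta> k * add_poch s (2 * h) \<gamma> k" for k
    unfolding add_poch_def prod.distrib[symmetric] bracket_def e ..
  have D: "(\<Prod>i=1..k. bracket s (u + of_nat i * h) Y) = add_poch s h (\<alpha> + h - \<beta>) k * add_poch s h (\<alpha> + h - \<gamma>) k" for k
    unfolding add_poch_def prod.distrib[symmetric]
    unfolding One_nat_def prod.atLeast1_atMost_eq bracket_def e by (simp only: mult.commute)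
  have split: "(\<Prod>i=1..n. bracket s (u + of_nat i * h) Y)
     = (\<Prod>i=1..k. bracket s (u + of_nat i * h) Y) * (\<Prod>i=Suc k..n. bracket s (u + of_nat i * h) Y)" if "k \<le> n" for k
    using prod.ub_add_nat[of 1 k "\<lambda>i. bracket s (u + of_nat i * h) Y" "n - k"] that by simp
  have Dn: "(\<Prod>i=1..n. bracket s (u + of_nat i * h) Y) \<noteq> 0"
    unfolding D using nz by simp
  have "(\<Prod>i<n. bracket s (u + (1 - of_nat n + 2 * of_nat i) * h) Y)
     = add_poch s (2 * h) (\<alpha> + (1 - of_nat n) * h - \<beta>) n * add_poch s (2 * h) (\<alpha> + (1 - of_nat n) * h - \<gamma>) n"
    unfolding add_poch_def prod.distrib[symmetric] bracket_def e by (simp only: mult.commute)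
  then have "?R = (\<Prod>i<n. bracket s (u + (1 - of_nat n + 2 * of_nat i) * h) Y) / (\<Prod>i=1..n. bracket s (u + of_nat i * h) Y) / K"
    unfolding D K_def by simp
  also have "\<dots> = (\<Sum>k\<le>n. quad_coeff h n k \<alpha> \<delta>
        * ((\<Prod>i<k. bracket s (t + 2 * of_nat i * h) Y) * (\<Prod>i=Suc k..n. bracket s (u + of_nat i * h) Y))
        / (\<Prod>i=1..n. bracket s (u + of_nat i * h) Y) / K)"
    using quad_newton[of h t u n Y] g unfolding tu by (simp add: sum_divide_distrib)
  also have "\<dots> = (\<Sum>k\<le>n. ?L k)"
  proof (rule sum.cong)
    fix k assume "k \<in> {..n}"
    then have k: "k \<le> n" by simp
    have "(\<Prod>i=Suc k..n. bracket s (u + of_nat i * h) Y) \<noteq> 0" using Dn split[OF k] by auto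
    then have "quad_coeff h n k \<alpha> \<delta>
        * ((\<Prod>i<k. bracket s (t + 2 * of_nat i * h) Y) * (\<Prod>i=Suc k..n. bracket s (u + of_nat i * h) Y))
        / (\<Prod>i=1..n. bracket s (u + of_nat i * h) Y) / K
       = quad_coeff h n k \<alpha> \<delta> / K * ((\<Prod>i<k. bracket s (t + 2 * of_nat i * h) Y) / (\<Prod>i=1..k. bracket s (u + of_nat i * h) Y))"
      unfolding split[OF k] by simp
    also have "quad_coeff h n k \<alpha> \<delta> / K = s (\<alpha> + 3 * of_nat k * h) / s \<alpha>
     * add_poch s (2 * h) \<delta> k / add_poch s h (\<alpha> + h - \<delta>) k
     * (add_poch s h \<alpha> k * add_poch s h ((of_nat n + 1) * h) k * add_poch s h (- of_nat n * h) k)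
     / (add_poch s (2 * h) (2 * h) k * add_poch s (2 * h) (\<alpha> + (1 - of_nat n) * h) k
        * add_poch s (2 * h) (\<alpha> + (of_nat n + 2) * h) k)"
    proof -
      have "quad_coeff h n k \<alpha> \<delta> = s (\<alpha> + 3 * of_nat k * h) / s \<alpha>
        * add_poch s (2 * h) \<delta> k / add_poch s h (\<alpha> + h - \<delta>) k
        * (add_poch s h \<alpha> k * add_poch s h ((of_nat n + 1) * h) k * add_poch s h (- of_nat n * h) k)
        / (add_poch s (2 * h) (2 * h) k * add_poch s (2 * h) (\<alpha> + (1 - of_nat n) * h) k
        * add_poch s (2 * h) (\<alpha> + (of_nat n + 2) * h) k) * K"
        by (simp add: quad_coeff_def K_def)
      then show ?thesis using K by simp
    qed
    also have "(\<Prod>i<k. bracket s (t + 2 * of_nat i * h) Y) / (\<Prod>i=1..k. bracket s (u + of_nat i * h) Y)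
      = add_poch s (2 * h) \<beta> k * add_poch s (2 * h) \<gamma> k / (add_poch s h (\<alpha> + h - \<beta>) k * add_poch s h (\<alpha> + h - \<gamma>) k)"
      unfolding P D ..
    finally show "quad_coeff h n k \<alpha> \<delta>
        * ((\<Prod>i<k. bracket s (t + 2 * of_nat i * h) Y) * (\<Prod>i=Suc k..n. bracket s (u + of_nat i * h) Y))
        / (\<Prod>i=1..n. bracket s (u + of_nat i * h) Y) / K = ?L k"
      by (simp add: ac_simps)
  qed simp
  finally show ?thesis by simp
qed

end

section \<open>The transformation for generic parameters\<close>

lemma add_poch_double: "add_poch f h x (2 * j) = add_poch f (2 * h) x j * add_poch f (2 * h) (x + h) j"
  by (induction j) (simp_all add: add_poch_Suc algebra_simps)

context odd_Weierstrass
begin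

section \<open>Factorial identities for the \<open>j\<close>-th term, sorted by parameter\<close>

lemma add_poch_neq_0I:
  assumes "\<And>i::int. s (x0 + of_int i * h) \<noteq> 0" "x = x0 + of_int i * h" "y = of_int j * h"
  shows "add_poch s y x n \<noteq> 0"
proof (rule add_poch_nonzeroI)
  fix k :: nat
  have "x + of_nat k * y = x0 + of_int (i + int k * j) * h"
    by (simp add: assms algebra_simps)
  then show "s (x + of_nat k * y) \<noteq> 0" using assms(1)[of "i + int k * j"] by simp
qed

text \<open>To be applied with \<open>x = \<delta> - \<alpha>\<close> and
  \<open>2 * j + l = n\<close>. Two products of length \<open>j\<close> are reversed, and their
  signs cancel; the rest is splitting.\<close>

lemma transformation_factor_delta:
  fixes j l :: nat
  assumes g: "\<And>i::int. s (x + of_int i * h) \<noteq> 0"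
  defines "J \<equiv> of_nat j" and "L \<equiv> of_nat l"
  shows "add_poch s h (x - J * h) (j + l) / (add_poch s h (h - x) j * add_poch s (2 * h) (x - (2 * J + L) * h) (j + l))
    = add_poch s h x (2 * j + l) / (add_poch s (2 * h) (x - (2 * J + L) * h) (2 * j + l)
        * add_poch s (2 * h) ((1 - (2 * J + L)) * h - x) j)"
proof -
  have nz: "add_poch s h (x - J * h) j \<noteq> 0" "add_poch s h (x + L * h) (2 * j) \<noteq> 0"
    by (rule add_poch_neq_0I[OF g, of _ "- int j" _ 1] add_poch_neq_0I[OF g, of _ "int l" _ 1],
        simp_all add: J_def L_def)+
  have r1: "add_poch s h (h - x) j = (-1) ^ j * add_poch s h (x - J * h) j"
    by (subst add_poch_reflect) (simp add: J_def algebra_simps)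
  have r2: "add_poch s (2 * h) ((1 - (2 * J + L)) * h - x) j = (-1) ^ j * add_poch s (2 * h) (x + L * h + h) j"
    by (subst add_poch_reflect) (simp add: J_def L_def algebra_simps)
  have a1: "add_poch s h (x - J * h) (j + l) = add_poch s h (x - J * h) j * add_poch s h x l"
    by (simp add: add_poch_add J_def)
  have "add_poch s h x (l + 2 * j) = add_poch s h x l * add_poch s h (x + L * h) (2 * j)"
    by (simp only: add_poch_add L_def)
  then have a2: "add_poch s h x (2 * j + l) = add_poch s h x l * add_poch s h (x + L * h) (2 * j)"
    by (simp add: add.commute)
  have e: "x - (2 * J + L) * h + of_nat (j + l) * (2 * h) = x + L * h"
    by (simp add: J_def L_def algebra_simps)
  have n: "2 * j + l = j + l + j" by simp
  have a3: "add_poch s (2 * h) (x - (2 * J + L) * h) (2 * j + l)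
      = add_poch s (2 * h) (x - (2 * J + L) * h) (j + l) * add_poch s (2 * h) (x + L * h) j"
    unfolding n add_poch_add[of s "2 * h" _ "j + l" j] e ..
  have m1: "(-1) ^ j * ((-1) ^ j) = (1 :: complex)"
    by (simp flip: power_mult_distrib)
  show ?thesis
    using nz unfolding r1 r2 a1 a2 a3 add_poch_double[of s h "x + L * h" j]
    by (simp add: field_simps m1)
qed

text \<open>Gathers the factors of the \<open>j\<close>-th coefficient that involve only
  \<open>\<alpha>\<close>, \<open>h\<close>, \<open>n\<close> and \<open>j\<close>. The two sides
  arise by cutting the same long products at different places.\<close>

lemma transformation_factor_alpha:
  fixes j l n :: nat
  assumes g: "\<And>i::int. s (\<alpha> + of_int i * h) \<noteq> 0" and g0: "\<And>i::int. i \<noteq> 0 \<Longrightarrow> s (of_int i * h) \<noteq> 0"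
    and n: "n = 2 * j + l"
  defines "J \<equiv> of_nat j" and "N \<equiv> of_nat n"
  shows "s (\<alpha> + 3 * J * h) / s \<alpha> * add_poch s h (- N * h) j / add_poch s (2 * h) (\<alpha> + (N + 2) * h) j
      * (add_poch s h (\<alpha> + 2 * J * h) j * add_poch s h ((N + 1 - 2 * J) * h) j
        / (add_poch s (2 * h) (\<alpha> + (2 * J - N - 1) * h) j * add_poch s (2 * h) (- 2 * J * h) j))
      * (add_poch s h (\<alpha> + 3 * J * h + h) (j + l) / add_poch s (2 * h) (\<alpha> + (1 - N + 4 * J) * h) (j + l))
    = add_poch s h (\<alpha> + h) n / add_poch s (2 * h) (\<alpha> + (1 - N) * h) n
      * (s (\<alpha> - (N + 1) * h + 4 * J * h) / s (\<alpha> - (N + 1) * h))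
      * (add_poch s (2 * h) (\<alpha> - (N + 1) * h) j * add_poch s (2 * h) ((1 - N) * h) j * add_poch s (2 * h) (- N * h) j
        / (add_poch s (2 * h) (2 * h) j * add_poch s (2 * h) \<alpha> j * add_poch s (2 * h) (\<alpha> + h) j))"
proof -
  \<comment> \<open>The logarithm of \<open>a^2/ef\<close>, the leading parameter of the
    series.\<close>
  define \<mu> where "\<mu> = \<alpha> - (N + 1) * h"
  \<comment> \<open>Two interleaved products of step \<open>2 * h\<close> make one of step
    \<open>h\<close> and length \<open>2 * j\<close>, whose second half is reversed.\<close>
  have q1: "add_poch s (2 * h) (- N * h) j * add_poch s (2 * h) ((1 - N) * h) j
     = add_poch s h (- N * h) j * ((-1) ^ j * add_poch s h ((N + 1 - 2 * J) * h) j)"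
  proof -
    have "add_poch s (2 * h) (- N * h) j * add_poch s (2 * h) (- N * h + h) j = add_poch s h (- N * h) (j + j)"
      by (simp only: add_poch_double[symmetric] mult_2[of j])
    also have "\<dots> = add_poch s h (- N * h) j * add_poch s h (- N * h + J * h) j"
      by (simp add: add_poch_add J_def)
    also have "add_poch s h (- N * h + J * h) j = (-1) ^ j * add_poch s h ((N + 1 - 2 * J) * h) j"
      by (subst add_poch_reflect) (simp add: J_def algebra_simps)
    finally show ?thesis by (simp add: algebra_simps)
  qed
  have q2: "add_poch s (2 * h) (- 2 * J * h) j = (-1) ^ j * add_poch s (2 * h) (2 * h) j"
    by (subst add_poch_reflect) (simp add: J_def algebra_simps)
  \<comment> \<open>The product of \<open>n + 2 * j + 1\<close> factors from \<open>\<alpha>\<close>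
    on in steps of \<open>h\<close>, cut in two ways.\<close>
  have a1: "add_poch s (2 * h) \<alpha> j * add_poch s (2 * h) (\<alpha> + h) j
      * (add_poch s h (\<alpha> + 2 * J * h) j * s (\<alpha> + 3 * J * h) * add_poch s h (\<alpha> + 3 * J * h + h) (j + l))
    = s \<alpha> * add_poch s h (\<alpha> + h) n * (add_poch s (2 * h) (\<alpha> + (N + 1) * h) j * add_poch s (2 * h) (\<alpha> + (N + 2) * h) j)"
  proof -
    have e: "\<alpha> + of_nat (2 * j) * h = \<alpha> + 2 * J * h" "\<alpha> + 2 * J * h + of_nat j * h = \<alpha> + 3 * J * h"
      "\<alpha> + h + of_nat n * h = \<alpha> + (N + 1) * h" "\<alpha> + (N + 1) * h + h = \<alpha> + (N + 2) * h"
      by (simp_all add: J_def N_def algebra_simps)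
    have "add_poch s h \<alpha> (2 * j + (j + Suc (j + l)))
      = add_poch s (2 * h) \<alpha> j * add_poch s (2 * h) (\<alpha> + h) j * (add_poch s h (\<alpha> + 2 * J * h) j
         * (s (\<alpha> + 3 * J * h) * add_poch s h (\<alpha> + 3 * J * h + h) (j + l)))"
      unfolding add_poch_add[of s h \<alpha>] add_poch_add[of s h _ j "Suc (j + l)"] add_poch_double e add_poch_Suc_shift[of s h _ "j + l"] ..
    moreover have "add_poch s h \<alpha> (Suc (n + 2 * j))
      = s \<alpha> * (add_poch s h (\<alpha> + h) n * (add_poch s (2 * h) (\<alpha> + (N + 1) * h) j * add_poch s (2 * h) (\<alpha> + (N + 2) * h) j))"
      unfolding add_poch_Suc_shift[of s h _ "n + 2 * j"] add_poch_add[of s h _ n] e add_poch_double ..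
    moreover have "2 * j + (j + Suc (j + l)) = Suc (n + 2 * j)" by (simp add: n)
    ultimately show ?thesis by (simp only: mult.assoc)
  qed
  \<comment> \<open>The product of \<open>n + j + 1\<close> factors from \<open>\<mu>\<close> on in
    steps of \<open>2 * h\<close>, cut in two ways.\<close>
  have a2: "s \<mu> * add_poch s (2 * h) (\<mu> + 2 * h) n * add_poch s (2 * h) (\<alpha> + (N + 1) * h) j
    = add_poch s (2 * h) \<mu> j * add_poch s (2 * h) (\<mu> + 2 * J * h) j * s (\<mu> + 4 * J * h)
       * add_poch s (2 * h) (\<mu> + 4 * J * h + 2 * h) (j + l)"
  proof -
    have e: "\<mu> + of_nat j * (2 * h) = \<mu> + 2 * J * h" "\<mu> + 2 * J * h + of_nat j * (2 * h) = \<mu> + 4 * J * h"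
      "\<mu> + 2 * h + of_nat n * (2 * h) = \<alpha> + (N + 1) * h"
      by (simp_all add: J_def N_def \<mu>_def algebra_simps)
    have "add_poch s (2 * h) \<mu> (j + (j + Suc (j + l)))
      = add_poch s (2 * h) \<mu> j * (add_poch s (2 * h) (\<mu> + 2 * J * h) j
         * (s (\<mu> + 4 * J * h) * add_poch s (2 * h) (\<mu> + 4 * J * h + 2 * h) (j + l)))"
      unfolding add_poch_add[of s "2 * h" \<mu>] add_poch_add[of s "2 * h" _ j "Suc (j + l)"] e add_poch_Suc_shift[of s "2 * h" _ "j + l"] ..
    moreover have "add_poch s (2 * h) \<mu> (Suc (n + j))
      = s \<mu> * (add_poch s (2 * h) (\<mu> + 2 * h) n * add_poch s (2 * h) (\<alpha> + (N + 1) * h) j)"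
      unfolding add_poch_Suc_shift[of s "2 * h" _ "n + j"] add_poch_add[of s "2 * h" _ n] e ..
    moreover have "j + (j + Suc (j + l)) = Suc (n + j)" by (simp add: n)
    ultimately show ?thesis by (simp only: mult.assoc)
  qed
  have e: "\<alpha> + (2 * J - N - 1) * h = \<mu> + 2 * J * h" "\<alpha> + (1 - N + 4 * J) * h = \<mu> + 4 * J * h + 2 * h"
     "\<alpha> + (1 - N) * h = \<mu> + 2 * h"
    by (simp_all add: \<mu>_def algebra_simps)
  have nz1: "s \<alpha> \<noteq> 0" using g[of 0] by simp
  have nz2: "s \<mu> \<noteq> 0" using g[of "- int n - 1"] by (simp add: \<mu>_def N_def algebra_simps)
  have nz3: "add_poch s (2 * h) \<alpha> j \<noteq> 0" by (rule add_poch_neq_0I[OF g, of _ 0 _ 2]) simp_all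
  have nz4: "add_poch s (2 * h) (\<alpha> + h) j \<noteq> 0" by (rule add_poch_neq_0I[OF g, of _ 1 _ 2]) simp_all
  have nz5: "add_poch s (2 * h) (\<alpha> + (N + 2) * h) j \<noteq> 0"
    by (rule add_poch_neq_0I[OF g, of _ "int n + 2" _ 2]) (simp_all add: N_def)
  have nz6: "add_poch s (2 * h) (\<mu> + 2 * J * h) j \<noteq> 0"
    by (rule add_poch_neq_0I[OF g, of _ "2 * int j - int n - 1" _ 2]) (simp_all add: N_def J_def \<mu>_def algebra_simps)
  have nz7: "add_poch s (2 * h) (\<mu> + 4 * J * h + 2 * h) (j + l) \<noteq> 0"
    by (rule add_poch_neq_0I[OF g, of _ "4 * int j - int n + 1" _ 2]) (simp_all add: N_def J_def \<mu>_def algebra_simps)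
  have nz8: "add_poch s (2 * h) (\<mu> + 2 * h) n \<noteq> 0"
    by (rule add_poch_neq_0I[OF g, of _ "1 - int n" _ 2]) (simp_all add: N_def \<mu>_def algebra_simps)
  have nz9: "add_poch s (2 * h) (2 * h) j \<noteq> 0"
  proof (rule add_poch_nonzeroI)
    fix i :: nat
    show "s (2 * h + of_nat i * (2 * h)) \<noteq> 0"
      using g0[of "2 + 2 * int i"] by (simp add: algebra_simps)
  qed
  have sq: "(-1) ^ j * ((-1) ^ j * x) = x" for x :: complex
    by (simp flip: mult.assoc power_mult_distrib)
  let ?Q = "add_poch s h (- N * h) j * add_poch s h ((N + 1 - 2 * J) * h) j * (-1) ^ j / add_poch s (2 * h) (2 * h) j"
  have "s (\<alpha> + 3 * J * h) / s \<alpha> * add_poch s h (- N * h) j / add_poch s (2 * h) (\<alpha> + (N + 2) * h) j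
      * (add_poch s h (\<alpha> + 2 * J * h) j * add_poch s h ((N + 1 - 2 * J) * h) j
        / (add_poch s (2 * h) (\<mu> + 2 * J * h) j * add_poch s (2 * h) (- 2 * J * h) j))
      * (add_poch s h (\<alpha> + 3 * J * h + h) (j + l) / add_poch s (2 * h) (\<mu> + 4 * J * h + 2 * h) (j + l))
    = (add_poch s (2 * h) \<alpha> j * add_poch s (2 * h) (\<alpha> + h) j
      * (add_poch s h (\<alpha> + 2 * J * h) j * s (\<alpha> + 3 * J * h) * add_poch s h (\<alpha> + 3 * J * h + h) (j + l)))
      / (s \<alpha> * add_poch s (2 * h) \<alpha> j * add_poch s (2 * h) (\<alpha> + h) j * add_poch s (2 * h) (\<alpha> + (N + 2) * h) j
        * add_poch s (2 * h) (\<mu> + 2 * J * h) j * add_poch s (2 * h) (\<mu> + 4 * J * h + 2 * h) (j + l)) * ?Q"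
    unfolding q2 using nz3 nz4 nz9 by (simp add: divide_simps sq)
  also have "\<dots> = add_poch s h (\<alpha> + h) n
      * (s \<mu> * add_poch s (2 * h) (\<mu> + 2 * h) n * add_poch s (2 * h) (\<alpha> + (N + 1) * h) j)
      / (s \<mu> * add_poch s (2 * h) (\<mu> + 2 * h) n * add_poch s (2 * h) \<alpha> j * add_poch s (2 * h) (\<alpha> + h) j
        * add_poch s (2 * h) (\<mu> + 2 * J * h) j * add_poch s (2 * h) (\<mu> + 4 * J * h + 2 * h) (j + l)) * ?Q"
    unfolding a1 using nz1 nz2 nz5 nz8 by (simp add: ac_simps)
  also have "\<dots> = add_poch s h (\<alpha> + h) n * s (\<mu> + 4 * J * h) * add_poch s (2 * h) \<mu> j
      / (s \<mu> * add_poch s (2 * h) (\<mu> + 2 * h) n * add_poch s (2 * h) \<alpha> j * add_poch s (2 * h) (\<alpha> + h) j) * ?Q"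
    unfolding a2 using nz6 nz7 by (simp add: ac_simps)
  also have "\<dots> = add_poch s h (\<alpha> + h) n / add_poch s (2 * h) (\<mu> + 2 * h) n
      * (s (\<mu> + 4 * J * h) / s \<mu>)
      * (add_poch s (2 * h) \<mu> j * (add_poch s (2 * h) (- N * h) j * add_poch s (2 * h) ((1 - N) * h) j)
        / (add_poch s (2 * h) (2 * h) j * add_poch s (2 * h) \<alpha> j * add_poch s (2 * h) (\<alpha> + h) j))"
    unfolding q1 by (simp add: ac_simps)
  finally show ?thesis
    unfolding e \<mu>_def[symmetric] by (simp only: mult_ac)
qed

text \<open>To be applied with \<open>x = \<beta>\<close> and \<open>x = \<gamma>\<close>: both
  products of length \<open>n\<close> are cut after \<open>j\<close> factors.\<close>

lemma transformation_factor_beta: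
  fixes j l n :: nat
  assumes n: "n = 2 * j + l" and nz: "add_poch s (2 * h) (\<alpha> + (1 - of_nat n) * h - x) j \<noteq> 0"
  shows "add_poch s (2 * h) x j / add_poch s h (\<alpha> + h - x) j
      * (add_poch s (2 * h) (\<alpha> + (1 - of_nat n + 2 * of_nat j) * h - x) (j + l)
        / add_poch s h (\<alpha> + h - x + of_nat j * h) (j + l))
    = add_poch s (2 * h) (\<alpha> + (1 - of_nat n) * h - x) n / add_poch s h (\<alpha> + h - x) n
      * (add_poch s (2 * h) x j / add_poch s (2 * h) (\<alpha> + (1 - of_nat n) * h - x) j)"
proof -
  have n': "n = j + (j + l)" by (simp add: n)
  have e: "\<alpha> + (1 - of_nat n) * h - x + of_nat j * (2 * h) = \<alpha> + (1 - of_nat n + 2 * of_nat j) * h - x"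
    by (simp add: algebra_simps)
  have "add_poch s (2 * h) (\<alpha> + (1 - of_nat n) * h - x) (j + (j + l))
     = add_poch s (2 * h) (\<alpha> + (1 - of_nat n) * h - x) j
       * add_poch s (2 * h) (\<alpha> + (1 - of_nat n + 2 * of_nat j) * h - x) (j + l)"
    by (simp only: add_poch_add[of s "2 * h" _ j "j + l"] e)
  then have 1: "add_poch s (2 * h) (\<alpha> + (1 - of_nat n) * h - x) n
     = add_poch s (2 * h) (\<alpha> + (1 - of_nat n) * h - x) j
       * add_poch s (2 * h) (\<alpha> + (1 - of_nat n + 2 * of_nat j) * h - x) (j + l)"
    by (simp only: n'[symmetric])
  have 2: "add_poch s h (\<alpha> + h - x) n = add_poch s h (\<alpha> + h - x) j * add_poch s h (\<alpha> + h - x + of_nat j * h) (j + l)"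
    by (subst n') (rule add_poch_add)
  show ?thesis unfolding 1 2 using nz by simp
qed

end

section \<open>Rearrangement of finite products and sums; both sides in additive notation\<close>

lemma prod_lessThan_add:
  fixes f :: "nat \<Rightarrow> 'a :: comm_monoid_mult"
  shows "(\<Prod>i<m + n. f i) = (\<Prod>i<m. f i) * (\<Prod>i<n. f (m + i))"
  by (induction n) (simp_all add: mult.assoc)

lemma sum_triangle:
  fixes f :: "nat \<Rightarrow> nat \<Rightarrow> 'a :: comm_monoid_add"
  shows "(\<Sum>k\<le>n. \<Sum>j\<le>k. f k j) = (\<Sum>j\<le>n. \<Sum>i\<le>n - j. f (j + i) j)"
proof (induction n)
  case (Suc n)
  have "(\<Sum>j\<le>n. \<Sum>i\<le>Suc n - j. f (j + i) j) = (\<Sum>j\<le>n. (\<Sum>i\<le>n - j. f (j + i) j) + f (Suc n) j)"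
    by (rule sum.cong) (auto simp: Suc_diff_le)
  then show ?case using Suc by (simp add: sum.distrib add.assoc)
qed simp

text \<open>No power \<open>q^k\<close> is left: the exponential factors that turn
  \<open>Etheta\<close> into an odd function absorb it.\<close>

definition quad_summand ::
    "(complex \<Rightarrow> complex) \<Rightarrow> complex \<Rightarrow> complex \<Rightarrow> complex \<Rightarrow> complex \<Rightarrow> complex \<Rightarrow> complex \<Rightarrow> complex \<Rightarrow> nat \<Rightarrow> nat \<Rightarrow> complex" where
  "quad_summand f h \<alpha> \<beta> \<gamma> \<delta> \<epsilon> \<phi> n k = f (\<alpha> + 3 * of_nat k * h) / f \<alpha>
      * (add_poch f (2 * h) \<beta> k * add_poch f (2 * h) \<gamma> k * add_poch f (2 * h) \<delta> k)
      / (add_poch f h (\<alpha> + h - \<beta>) k * add_poch f h (\<alpha> + h - \<gamma>) k * add_poch f h (\<alpha> + h - \<delta>) k)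
      * (add_poch f h \<epsilon> k * add_poch f h \<phi> k * add_poch f h (- of_nat n * h) k)
      / (add_poch f (2 * h) (\<alpha> + 2 * h - \<epsilon>) k * add_poch f (2 * h) (\<alpha> + 2 * h - \<phi>) k
        * add_poch f (2 * h) (\<alpha> + (of_nat n + 2) * h) k)"

definition quad_prefactor ::
    "(complex \<Rightarrow> complex) \<Rightarrow> complex \<Rightarrow> complex \<Rightarrow> complex \<Rightarrow> complex \<Rightarrow> complex \<Rightarrow> nat \<Rightarrow> complex" where
  "quad_prefactor f h \<alpha> \<beta> \<gamma> \<delta> n = add_poch f h (\<alpha> + h) n * add_poch f h (\<delta> - \<alpha>) n
      * (add_poch f (2 * h) (\<alpha> + (1 - of_nat n) * h - \<beta>) n * add_poch f (2 * h) (\<alpha> + (1 - of_nat n) * h - \<gamma>) n)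
      / (add_poch f h (\<alpha> + h - \<beta>) n * add_poch f h (\<alpha> + h - \<gamma>) n
        * (add_poch f (2 * h) (\<alpha> + (1 - of_nat n) * h) n * add_poch f (2 * h) (\<delta> - \<alpha> - of_nat n * h) n))"

text \<open>In the denominator \<open>\<epsilon>\<close> and \<open>\<phi>\<close> change places,
  because \<open>\<alpha> + 2 * h - \<phi>\<close> is the partner of
  \<open>\<alpha> - \<epsilon>\<close>. The last two bases, \<open>\<alpha>\<close> and
  \<open>\<alpha> + h\<close>, are the partners of \<open>(1 - n) * h\<close> and
  \<open>- n * h\<close>.\<close>

definition quad_omega_summand ::
    "(complex \<Rightarrow> complex) \<Rightarrow> complex \<Rightarrow> complex \<Rightarrow> complex \<Rightarrow> complex \<Rightarrow> complex \<Rightarrow> complex \<Rightarrow> complex \<Rightarrow> nat \<Rightarrow> nat \<Rightarrow> complex" where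
  "quad_omega_summand f h \<alpha> \<beta> \<gamma> \<delta> \<epsilon> \<phi> n j =
      f (\<alpha> - (of_nat n + 1) * h + 4 * of_nat j * h) / f (\<alpha> - (of_nat n + 1) * h)
        * (add_poch f (2 * h) (\<alpha> - (of_nat n + 1) * h) j
          * add_poch f (2 * h) \<beta> j * add_poch f (2 * h) \<gamma> j * add_poch f (2 * h) \<delta> j
          * add_poch f (2 * h) (\<alpha> - \<epsilon>) j * add_poch f (2 * h) (\<alpha> - \<phi>) j
          * add_poch f (2 * h) ((1 - of_nat n) * h) j * add_poch f (2 * h) (- of_nat n * h) j)
        / (add_poch f (2 * h) (2 * h) j * add_poch f (2 * h) (\<alpha> + (1 - of_nat n) * h - \<beta>) j
          * add_poch f (2 * h) (\<alpha> + (1 - of_nat n) * h - \<gamma>) j * add_poch f (2 * h) (\<alpha> + (1 - of_nat n) * h - \<delta>) j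
          * add_poch f (2 * h) (\<alpha> + 2 * h - \<phi>) j * add_poch f (2 * h) (\<alpha> + 2 * h - \<epsilon>) j
          * add_poch f (2 * h) \<alpha> j * add_poch f (2 * h) (\<alpha> + h) j)"

context odd_Weierstrass
begin

theorem quadratic_transformation_generic:
  fixes n :: nat
  assumes g: "quad_generic h \<alpha> \<delta>"
    and bal1: "\<beta> + \<gamma> + \<delta> = 2 * \<alpha> + h" and bal2: "\<epsilon> + \<phi> = \<alpha> + (of_nat n + 1) * h"
    and g\<beta>: "\<And>i::int. s (\<alpha> - \<beta> + of_int i * h) \<noteq> 0" and g\<gamma>: "\<And>i::int. s (\<alpha> - \<gamma> + of_int i * h) \<noteq> 0"
    and g\<epsilon>: "\<And>i::int. s (\<alpha> - \<epsilon> + of_int i * h) \<noteq> 0" and g\<epsilon>': "\<And>i::int. s (\<epsilon> + of_int i * h) \<noteq> 0"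
  shows "(\<Sum>k\<le>n. quad_summand s h \<alpha> \<beta> \<gamma> \<delta> \<epsilon> \<phi> n k)
    = quad_prefactor s h \<alpha> \<beta> \<gamma> \<delta> n * (\<Sum>j\<le>n div 2. quad_omega_summand s h \<alpha> \<beta> \<gamma> \<delta> \<epsilon> \<phi> n j)"
    (is "(\<Sum>k\<le>n. ?L k) = ?pref * (\<Sum>j\<le>n div 2. ?\<omega> j)")
proof -
  define N where "N = (of_nat n :: complex)"
  have g\<alpha>: "s (\<alpha> + of_int i * h) \<noteq> 0" for i using g unfolding quad_generic_def by blast
  have g0: "s (of_int i * h) \<noteq> 0" if "i \<noteq> 0" for i using g that unfolding quad_generic_def by blast
  have g\<delta>: "s (\<delta> - \<alpha> + of_int i * h) \<noteq> 0" for i by (rule quad_genericD(4)[OF g refl])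
  \<comment> \<open>\<open>X\<close> is half of \<open>\<epsilon> - \<phi>\<close>. Since
    \<open>\<epsilon> + \<phi>\<close> is prescribed, the nodes \<open>A i\<close> and
    \<open>B i\<close> do not involve \<open>\<epsilon>\<close>, and the brackets with
    \<open>X\<close> reproduce the paired factors in \<open>\<epsilon>\<close> and
    \<open>\<phi>\<close>.\<close>
  define A where "A i = (\<alpha> + (N + 1 + 2 * of_nat i) * h) / 2" for i :: nat
  define B where "B i = (\<alpha> + (4 * of_nat i - N - 1) * h) / 2" for i :: nat
  define X where "X = \<epsilon> - (\<alpha> + (N + 1) * h) / 2"
  have \<phi>: "\<phi> = \<alpha> + (N + 1) * h - \<epsilon>" using bal2 by (simp add: N_def algebra_simps)
  have AX: "bracket s (A i) X = s (\<epsilon> + of_nat i * h) * s (\<phi> + of_nat i * h)" for i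
  proof -
    have "A i + X = \<epsilon> + of_nat i * h" "A i - X = \<phi> + of_nat i * h"
      by (simp_all add: A_def X_def \<phi> field_simps)
    then show ?thesis by (simp add: bracket_def)
  qed
  have BX: "bracket s (B i) X = s (\<alpha> - \<phi> + of_nat i * (2 * h)) * s (\<alpha> - \<epsilon> + of_nat i * (2 * h))" for i
  proof -
    have "B i + X = \<alpha> - \<phi> + of_nat i * (2 * h)" "B i - X = \<alpha> - \<epsilon> + of_nat i * (2 * h)"
      by (simp_all add: B_def X_def \<phi> field_simps)
    then show ?thesis by (simp add: bracket_def)
  qed
  have BX': "bracket s (B (Suc i)) X = s (\<alpha> + 2 * h - \<phi> + of_nat i * (2 * h)) * s (\<alpha> + 2 * h - \<epsilon> + of_nat i * (2 * h))" for i
    unfolding BX by (simp add: algebra_simps)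
  \<comment> \<open>As \<open>\<alpha> - \<phi> = \<epsilon> - (n + 1) * h\<close>, conditions on
    \<open>\<epsilon>\<close> control both factors.\<close>
  have BX_nz: "bracket s (B i) X \<noteq> 0" for i
    using g\<epsilon>[of "2 * int i"] g\<epsilon>'[of "2 * int i - int n - 1"] unfolding BX \<phi> by (simp add: N_def algebra_simps)
  have AB: "bracket s (A i) (B j) = s (\<alpha> + (2 * of_nat j + of_nat i) * h) * s ((N + 1 - 2 * of_nat j + of_nat i) * h)" for i j
  proof -
    have "A i + B j = \<alpha> + (2 * of_nat j + of_nat i) * h" "A i - B j = (N + 1 - 2 * of_nat j + of_nat i) * h"
      by (simp_all add: A_def B_def field_simps)
    then show ?thesis by (simp add: bracket_def)
  qed
  have BB: "bracket s (B i) (B j) = s (\<alpha> + (2 * of_nat i + 2 * of_nat j - N - 1) * h) * s (2 * (of_nat i - of_nat j) * h)" for i j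
  proof -
    have "B i + B j = \<alpha> + (2 * of_nat i + 2 * of_nat j - N - 1) * h" "B i - B j = 2 * (of_nat i - of_nat j) * h"
      by (simp_all add: B_def field_simps)
    then show ?thesis by (simp add: bracket_def)
  qed
  have BB_nz: "bracket s (B i) (B j) \<noteq> 0" if "i \<noteq> j" for i j
    using g\<alpha>[of "2 * int i + 2 * int j - int n - 1"] g0[of "2 * (int i - int j)"] that unfolding BB N_def by simp

  define r where "r k j = (\<Prod>i<k. bracket s (A i) (B j)) / (\<Prod>i\<in>{..k} - {j}. bracket s (B i) (B j))" for k j
  \<comment> \<open>All dependence on \<open>X\<close> sits here. The denominators of a summand
    begin with \<open>B 1\<close>; the bracket with \<open>B 0\<close> supplies the additional
    denominator that the partial fraction expansion has.\<close>
  define E where "E j = bracket s (B 0) X / bracket s (B j) X" for j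
  define C where "C k = s (\<alpha> + 3 * of_nat k * h) / s \<alpha>
      * (add_poch s (2 * h) \<beta> k * add_poch s (2 * h) \<gamma> k * add_poch s (2 * h) \<delta> k)
      / (add_poch s h (\<alpha> + h - \<beta>) k * add_poch s h (\<alpha> + h - \<gamma>) k * add_poch s h (\<alpha> + h - \<delta>) k)
      * add_poch s h (- N * h) k / add_poch s (2 * h) (\<alpha> + (N + 2) * h) k" for k
  have L: "?L k = (\<Sum>j\<le>k. C k * r k j * E j)" for k
  proof -
    have "?L k = C k * ((\<Prod>i<k. bracket s (A i) X) / (\<Prod>i<k. bracket s (B (Suc i)) X))"
      unfolding AX BX' prod.distrib add_poch_def[symmetric] by (simp add: C_def quad_summand_def N_def mult_ac)
    also have "\<dots> = C k * bracket s (B 0) X * ((\<Prod>i<k. bracket s (A i) X) / (\<Prod>i\<le>k. bracket s (B i) X))"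
      using BX_nz[of 0] by (simp add: prod.atMost_shift)
    also have "\<dots> = (\<Sum>j\<le>k. C k * r k j * E j)"
      by (subst partial_fractions) (simp_all add: BB_nz BX_nz sum_distrib_left r_def E_def mult_ac)
    finally show ?thesis .
  qed

  have inner: "(\<Sum>i\<le>n - j. C (j + i) * r (j + i) j * E j) = (if 2 * j \<le> n then ?pref * ?\<omega> j else 0)"
    if j: "j \<le> n" for j
  proof -
    define m where "m = n - j"
    define J where "J = (of_nat j :: complex)"
    have mN: "of_nat m = N - J" using j by (simp add: m_def N_def J_def of_nat_diff)
    define S where "S i = s (\<alpha> + 3 * J * h + 3 * of_nat i * h) / s (\<alpha> + 3 * J * h)
      * (add_poch s (2 * h) (\<beta> + 2 * J * h) i * add_poch s (2 * h) (\<gamma> + 2 * J * h) i * add_poch s (2 * h) (\<delta> + 2 * J * h) i)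
      / (add_poch s h (\<alpha> + 3 * J * h + h - (\<beta> + 2 * J * h)) i * add_poch s h (\<alpha> + 3 * J * h + h - (\<gamma> + 2 * J * h)) i
         * add_poch s h (\<alpha> + 3 * J * h + h - (\<delta> + 2 * J * h)) i)
      * (add_poch s h (\<alpha> + 3 * J * h) i * add_poch s h ((of_nat m + 1) * h) i * add_poch s h (- of_nat m * h) i)
      / (add_poch s (2 * h) (2 * h) i * add_poch s (2 * h) (\<alpha> + 3 * J * h + (1 - of_nat m) * h) i
        * add_poch s (2 * h) (\<alpha> + 3 * J * h + (of_nat m + 2) * h) i)" for i
    \<comment> \<open>Factors with index below \<open>j\<close> are constant in \<open>i\<close>.
      The others become the factorials of a quadratic summation whose \<open>\<epsilon>\<close>
      equals its \<open>\<alpha>\<close>, now \<open>\<alpha> + 3 * J * h\<close>.\<close>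
    have r: "r (j + i) j = r j j * (add_poch s h (\<alpha> + 3 * J * h) i * add_poch s h ((of_nat m + 1) * h) i)
        / (add_poch s (2 * h) (2 * h) i * add_poch s (2 * h) (\<alpha> + 3 * J * h + (1 - of_nat m) * h) i)" for i
    proof -
      have num: "(\<Prod>i'<j + i. bracket s (A i') (B j)) = (\<Prod>i'<j. bracket s (A i') (B j))
          * (add_poch s h (\<alpha> + 3 * J * h) i * add_poch s h ((of_nat m + 1) * h) i)"
      proof -
        have e: "\<alpha> + (2 * of_nat j + of_nat (j + i')) * h = \<alpha> + 3 * J * h + of_nat i' * h"
          "(N + 1 - 2 * of_nat j + of_nat (j + i')) * h = (of_nat m + 1) * h + of_nat i' * h" for i'
          by (simp_all add: J_def mN algebra_simps)
        show ?thesis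
          unfolding prod_lessThan_add[of _ j i] AB[of "j + _" j] e add_poch_def prod.distrib ..
      qed
      have den: "(\<Prod>i'\<in>{..j + i} - {j}. bracket s (B i') (B j)) = (\<Prod>i'\<in>{..j} - {j}. bracket s (B i') (B j))
          * (add_poch s (2 * h) (2 * h) i * add_poch s (2 * h) (\<alpha> + 3 * J * h + (1 - of_nat m) * h) i)"
      proof -
        have e: "\<alpha> + (2 * of_nat (Suc j + i') + 2 * of_nat j - N - 1) * h
            = \<alpha> + 3 * J * h + (1 - of_nat m) * h + of_nat i' * (2 * h)"
          "2 * (of_nat (Suc j + i') - of_nat j) * h = 2 * h + of_nat i' * (2 * h)" for i'
          by (simp_all add: J_def mN algebra_simps)
        have "{..j + i} - {j} = ({..j} - {j}) \<union> (\<lambda>i'. Suc j + i') ` {..<i}"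
        proof -
          have "x \<in> (\<lambda>i'. Suc j + i') ` {..<i}" if "x \<le> j + i" "x > j" for x
            using that by (intro image_eqI[of _ _ "x - Suc j"]) auto
          then have "(\<lambda>i'. Suc j + i') ` {..<i} = {Suc j..j + i}" by fastforce
          then show ?thesis by auto
        qed
        then have "(\<Prod>i'\<in>{..j + i} - {j}. bracket s (B i') (B j)) = (\<Prod>i'\<in>{..j} - {j}. bracket s (B i') (B j))
            * (\<Prod>i'\<in>(\<lambda>i'. Suc j + i') ` {..<i}. bracket s (B i') (B j))"
          by (simp only:) (rule prod.union_disjoint, auto)
        also have "(\<Prod>i'\<in>(\<lambda>i'. Suc j + i') ` {..<i}. bracket s (B i') (B j)) = (\<Prod>i'<i. bracket s (B (Suc j + i')) (B j))"
          by (subst prod.reindex) (auto simp: inj_on_def)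
        also have "\<dots> = add_poch s (2 * h) (2 * h) i * add_poch s (2 * h) (\<alpha> + 3 * J * h + (1 - of_nat m) * h) i"
          unfolding BB[of "Suc j + _" j] e add_poch_def prod.distrib by (rule mult.commute)
        finally show ?thesis .
      qed
      show ?thesis unfolding r_def num den by simp
    qed
    have C: "C (j + i) * r (j + i) j = C j * r j j * S i" for i
    proof -
      have nz: "s (\<alpha> + 3 * J * h) \<noteq> 0" using g\<alpha>[of "3 * int j"] by (simp add: J_def)
      have e: "\<alpha> + 3 * of_nat (j + i) * h = \<alpha> + 3 * J * h + 3 * of_nat i * h"
        "\<alpha> + 3 * of_nat j * h = \<alpha> + 3 * J * h"
        "x + of_nat j * (2 * h) = x + 2 * J * h"
        "\<alpha> + h - x + of_nat j * h = \<alpha> + 3 * J * h + h - (x + 2 * J * h)"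
        "- N * h + of_nat j * h = - of_nat m * h"
        "\<alpha> + (N + 2) * h + 2 * J * h = \<alpha> + 3 * J * h + (of_nat m + 2) * h" for x
        by (simp_all add: J_def mN algebra_simps)
      have C: "C (j + i) = C j * (s (\<alpha> + 3 * J * h + 3 * of_nat i * h) / s (\<alpha> + 3 * J * h)
        * (add_poch s (2 * h) (\<beta> + 2 * J * h) i * add_poch s (2 * h) (\<gamma> + 2 * J * h) i * add_poch s (2 * h) (\<delta> + 2 * J * h) i)
        / (add_poch s h (\<alpha> + 3 * J * h + h - (\<beta> + 2 * J * h)) i * add_poch s h (\<alpha> + 3 * J * h + h - (\<gamma> + 2 * J * h)) i
         * add_poch s h (\<alpha> + 3 * J * h + h - (\<delta> + 2 * J * h)) i)
        * add_poch s h (- of_nat m * h) i / add_poch s (2 * h) (\<alpha> + 3 * J * h + (of_nat m + 2) * h) i)"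
        unfolding C_def add_poch_add e using nz by (simp add: ac_simps)
      show ?thesis unfolding C r S_def by (simp add: ac_simps)
    qed
    have sum: "(\<Sum>i\<le>n - j. C (j + i) * r (j + i) j * E j) = C j * r j j * E j * (\<Sum>i\<le>m. S i)"
      unfolding C m_def by (simp add: sum_distrib_left mult_ac)
    show ?thesis
    proof (cases "2 * j \<le> n")
      case False
      \<comment> \<open>For this index a numerator node meets the pole, \<open>A i = B j\<close>, so
        the residue contains \<open>s 0\<close>.\<close>
      define i where "i = 2 * j - n - 1"
      have i: "i < j" "(N + 1 - 2 * of_nat j + of_nat i) * h = 0"
        using False j by (simp_all add: i_def N_def of_nat_diff)
      have "bracket s (A i) (B j) = 0" unfolding AB i by (simp add: s_0)
      then have "(\<Prod>i<j. bracket s (A i) (B j)) = 0" using i(1) by auto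
      then have "r j j = 0" by (simp add: r_def)
      then show ?thesis using False sum by simp
    next
      case True
      define l where "l = n - 2 * j"
      have l: "n = 2 * j + l" "m = j + l" using True by (simp_all add: l_def m_def)
      have lN: "of_nat l = N - 2 * J" using True by (simp add: l_def N_def J_def of_nat_diff)
      have gen': "quad_generic h (\<alpha> + 3 * J * h) (\<delta> + 2 * J * h)"
        using quad_generic_shift[OF g, of "3 * int j" "2 * int j"] by (simp add: J_def)
      have bal': "\<beta> + 2 * J * h + (\<gamma> + 2 * J * h) + (\<delta> + 2 * J * h) = 2 * (\<alpha> + 3 * J * h) + h"
        using bal1 by (simp add: algebra_simps)
      have nz': "add_poch s h (\<alpha> + 3 * J * h + h - (\<beta> + 2 * J * h)) m \<noteq> 0"
         "add_poch s h (\<alpha> + 3 * J * h + h - (\<gamma> + 2 * J * h)) m \<noteq> 0"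
        by (rule add_poch_neq_0I[OF g\<beta>, of _ "1 + int j" _ 1] add_poch_neq_0I[OF g\<gamma>, of _ "1 + int j" _ 1],
          simp_all add: J_def algebra_simps)+
      have e: "\<alpha> + 3 * J * h + h - (x + 2 * J * h) = \<alpha> + h - x + J * h"
        "\<alpha> + (1 - N + 4 * J) * h - (x + 2 * J * h) = \<alpha> + (1 - N + 2 * J) * h - x"
        "\<delta> + 2 * J * h - (\<alpha> + 3 * J * h) = \<delta> - \<alpha> - J * h"
        "\<alpha> + 3 * J * h + (1 - of_nat m) * h = \<alpha> + (1 - N + 4 * J) * h"
        "\<delta> - \<alpha> - J * h - of_nat m * h = \<delta> - \<alpha> - N * h" for x
        by (simp_all add: mN algebra_simps)
      have S: "(\<Sum>i\<le>m. S i) = add_poch s h (\<alpha> + 3 * J * h + h) m * add_poch s h (\<delta> - \<alpha> - J * h) m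
        * (add_poch s (2 * h) (\<alpha> + (1 - N + 2 * J) * h - \<beta>) m * add_poch s (2 * h) (\<alpha> + (1 - N + 2 * J) * h - \<gamma>) m)
        / (add_poch s h (\<alpha> + h - \<beta> + J * h) m * add_poch s h (\<alpha> + h - \<gamma> + J * h) m
          * (add_poch s (2 * h) (\<alpha> + (1 - N + 4 * J) * h) m * add_poch s (2 * h) (\<delta> - \<alpha> - N * h) m))"
        using quadratic_summation[OF gen' bal' nz'] unfolding e S_def .
      have rjj: "r j j = add_poch s h (\<alpha> + 2 * J * h) j * add_poch s h ((N + 1 - 2 * J) * h) j
        / (add_poch s (2 * h) (\<alpha> + (2 * J - N - 1) * h) j * add_poch s (2 * h) (- 2 * J * h) j)"
      proof -
        have e: "\<alpha> + (2 * of_nat j + of_nat i) * h = \<alpha> + 2 * J * h + of_nat i * h"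
          "(N + 1 - 2 * of_nat j + of_nat i) * h = (N + 1 - 2 * J) * h + of_nat i * h"
          "\<alpha> + (2 * of_nat i + 2 * of_nat j - N - 1) * h = \<alpha> + (2 * J - N - 1) * h + of_nat i * (2 * h)"
          "2 * (of_nat i - of_nat j) * h = - 2 * J * h + of_nat i * (2 * h)" for i
          by (simp_all add: J_def algebra_simps)
        have "{..j} - {j} = {..<j}" by auto
        then show ?thesis
          unfolding r_def AB BB e add_poch_def prod.distrib by (simp only:)
      qed
      have Ej: "E j = add_poch s (2 * h) (\<alpha> - \<epsilon>) j * add_poch s (2 * h) (\<alpha> - \<phi>) j
        / (add_poch s (2 * h) (\<alpha> + 2 * h - \<phi>) j * add_poch s (2 * h) (\<alpha> + 2 * h - \<epsilon>) j)"
      proof -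
        \<comment> \<open>A quotient of two products shifted by one telescopes to
          \<open>E j\<close>.\<close>
        have "(\<Prod>i<j. bracket s (B i) X) * bracket s (B j) X = bracket s (B 0) X * (\<Prod>i<j. bracket s (B (Suc i)) X)"
          using prod.lessThan_Suc_shift[of "\<lambda>i. bracket s (B i) X" j] by (simp add: mult.commute)
        moreover have "(\<Prod>i<j. bracket s (B (Suc i)) X) \<noteq> 0" using BX_nz by simp
        ultimately have "E j = (\<Prod>i<j. bracket s (B i) X) / (\<Prod>i<j. bracket s (B (Suc i)) X)"
          using BX_nz[of j] by (simp add: E_def field_simps)
        then show ?thesis unfolding BX' unfolding BX prod.distrib add_poch_def[symmetric] by (simp only: mult.commute)
      qed
      have F\<alpha>: "s (\<alpha> + 3 * J * h) / s \<alpha> * add_poch s h (- N * h) j / add_poch s (2 * h) (\<alpha> + (N + 2) * h) j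
        * (add_poch s h (\<alpha> + 2 * J * h) j * add_poch s h ((N + 1 - 2 * J) * h) j
          / (add_poch s (2 * h) (\<alpha> + (2 * J - N - 1) * h) j * add_poch s (2 * h) (- 2 * J * h) j))
        * (add_poch s h (\<alpha> + 3 * J * h + h) m / add_poch s (2 * h) (\<alpha> + (1 - N + 4 * J) * h) m)
      = add_poch s h (\<alpha> + h) n / add_poch s (2 * h) (\<alpha> + (1 - N) * h) n
        * (s (\<alpha> - (N + 1) * h + 4 * J * h) / s (\<alpha> - (N + 1) * h))
        * (add_poch s (2 * h) (\<alpha> - (N + 1) * h) j * add_poch s (2 * h) ((1 - N) * h) j * add_poch s (2 * h) (- N * h) j
          / (add_poch s (2 * h) (2 * h) j * add_poch s (2 * h) \<alpha> j * add_poch s (2 * h) (\<alpha> + h) j))"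
        using transformation_factor_alpha[OF g\<alpha> g0 l(1)] unfolding J_def N_def l(2) by simp
      have F\<beta>: "add_poch s (2 * h) x j / add_poch s h (\<alpha> + h - x) j
        * (add_poch s (2 * h) (\<alpha> + (1 - N + 2 * J) * h - x) m / add_poch s h (\<alpha> + h - x + J * h) m)
        = add_poch s (2 * h) (\<alpha> + (1 - N) * h - x) n / add_poch s h (\<alpha> + h - x) n
          * (add_poch s (2 * h) x j / add_poch s (2 * h) (\<alpha> + (1 - N) * h - x) j)"
        if gx: "\<And>i::int. s (\<alpha> - x + of_int i * h) \<noteq> 0" for x
      proof -
        have "add_poch s (2 * h) (\<alpha> + (1 - of_nat n) * h - x) j \<noteq> 0"
          by (rule add_poch_neq_0I[OF gx, of _ "1 - int n" _ 2]) simp_all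
        from transformation_factor_beta[OF l(1) this] show ?thesis
          unfolding J_def N_def l(2) .
      qed
      have F\<delta>: "add_poch s h (\<delta> - \<alpha> - J * h) m / (add_poch s h (\<alpha> + h - \<delta>) j * add_poch s (2 * h) (\<delta> - \<alpha> - N * h) m)
        = add_poch s h (\<delta> - \<alpha>) n / (add_poch s (2 * h) (\<delta> - \<alpha> - N * h) n * add_poch s (2 * h) (\<alpha> + (1 - N) * h - \<delta>) j)"
      proof -
        have e: "2 * J + of_nat l = N" "h - (\<delta> - \<alpha>) = \<alpha> + h - \<delta>" "(1 - N) * h - (\<delta> - \<alpha>) = \<alpha> + (1 - N) * h - \<delta>"
          by (simp_all add: lN)
        show ?thesis
          using transformation_factor_delta[OF g\<delta>, of j l]
          unfolding J_def[symmetric] l(1)[symmetric] l(2)[symmetric] e .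
      qed
      \<comment> \<open>Grouped by parameter so that each group contains the left-hand side of one
        of the factor identities; \<open>\<epsilon>\<close> and \<open>\<phi>\<close> occur only in
        \<open>E j\<close>.\<close>
      have rearrange: "C j * r j j * E j * (\<Sum>i\<le>m. S i)
        = (s (\<alpha> + 3 * J * h) / s \<alpha> * add_poch s h (- N * h) j / add_poch s (2 * h) (\<alpha> + (N + 2) * h) j
        * (add_poch s h (\<alpha> + 2 * J * h) j * add_poch s h ((N + 1 - 2 * J) * h) j
          / (add_poch s (2 * h) (\<alpha> + (2 * J - N - 1) * h) j * add_poch s (2 * h) (- 2 * J * h) j))
        * (add_poch s h (\<alpha> + 3 * J * h + h) m / add_poch s (2 * h) (\<alpha> + (1 - N + 4 * J) * h) m))
        * (add_poch s (2 * h) \<beta> j / add_poch s h (\<alpha> + h - \<beta>) j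
        * (add_poch s (2 * h) (\<alpha> + (1 - N + 2 * J) * h - \<beta>) m / add_poch s h (\<alpha> + h - \<beta> + J * h) m))
        * (add_poch s (2 * h) \<gamma> j / add_poch s h (\<alpha> + h - \<gamma>) j
        * (add_poch s (2 * h) (\<alpha> + (1 - N + 2 * J) * h - \<gamma>) m / add_poch s h (\<alpha> + h - \<gamma> + J * h) m))
        * (add_poch s (2 * h) \<delta> j * (add_poch s h (\<delta> - \<alpha> - J * h) m
           / (add_poch s h (\<alpha> + h - \<delta>) j * add_poch s (2 * h) (\<delta> - \<alpha> - N * h) m))) * E j"
        unfolding S rjj C_def J_def[symmetric]
        by (simp only: times_divide_eq_left times_divide_eq_right divide_divide_eq_left times_divide_times_eq mult_ac)
      have "C j * r j j * E j * (\<Sum>i\<le>m. S i) = ?pref * ?\<omega> j"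
        unfolding rearrange unfolding F\<alpha> F\<beta>[OF g\<beta>] F\<beta>[OF g\<gamma>] F\<delta> Ej
          quad_prefactor_def quad_omega_summand_def J_def[symmetric] N_def[symmetric]
        by (simp only: times_divide_eq_left times_divide_eq_right divide_divide_eq_left times_divide_times_eq mult_ac)
      then show ?thesis using True sum by simp
    qed
  qed

  have "(\<Sum>k\<le>n. ?L k) = (\<Sum>k\<le>n. \<Sum>j\<le>k. C k * r k j * E j)"
    unfolding L ..
  also have "\<dots> = (\<Sum>j\<le>n. \<Sum>i\<le>n - j. C (j + i) * r (j + i) j * E j)"
    by (rule sum_triangle)
  also have "\<dots> = (\<Sum>j\<le>n. if 2 * j \<le> n then ?pref * ?\<omega> j else 0)"
    using inner by (intro sum.cong) auto
  also have "\<dots> = (\<Sum>j\<le>n div 2. ?pref * ?\<omega> j)"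
    by (rule sum.mono_neutral_cong_right) auto
  also have "\<dots> = ?pref * (\<Sum>j\<le>n div 2. ?\<omega> j)"
    by (simp only: sum_distrib_left)
  finally show ?thesis .
qed

end

section \<open>Removal of the genericity assumptions\<close>

lemma odd_Weierstrass_odd_theta: "norm p < 1 \<Longrightarrow> odd_Weierstrass (odd_theta p)"
  by (rule odd_Weierstrass.intro) (rule odd_theta_minus bracket_Weierstrass, assumption)+

lemma countable_odd_theta_affine_zeros:
  assumes "norm p < 1" "c \<noteq> 0"
  shows "countable {z. odd_theta p (x + c * z) = 0}"
proof (rule countable_subset)
  show "{z. odd_theta p (x + c * z) = 0} \<subseteq> (\<lambda>w. (w - x) / c) ` {w. odd_theta p w = 0}"
  proof
    fix z assume "z \<in> {z. odd_theta p (x + c * z) = 0}"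
    then show "z \<in> (\<lambda>w. (w - x) / c) ` {w. odd_theta p w = 0}"
      using assms(2) by (intro image_eqI[of _ _ "x + c * z"]) simp_all
  qed
qed (simp add: countable_odd_theta_zeros[OF assms(1)])

lemma isCont_odd_theta_compose:
  assumes "norm p < 1" "isCont f z"
  shows "isCont (\<lambda>z. odd_theta p (f z)) z"
  using assms unfolding isCont_def by (intro tendsto_odd_theta)

lemma isCont_add_poch_compose:
  assumes "norm p < 1" "isCont f z" "isCont g z"
  shows "isCont (\<lambda>z. add_poch (odd_theta p) (f z) (g z) k) z"
  unfolding add_poch_def by (intro continuous_prod isCont_odd_theta_compose assms isCont_add isCont_mult continuous_const)

text \<open>The degenerate parameters are reached from generic ones along the line on which
  \<open>\<alpha>\<close>, \<open>h\<close>, \<open>\<delta>\<close>, \<open>\<epsilon>\<close> move with speeds \<open>1\<close>, \<open>3\<close>, \<open>5\<close>, \<open>2\<close>: there every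
  genericity condition excludes only countably many points.\<close>

theorem quadratic_transformation_odd_theta:
  fixes n :: nat
  assumes p: "norm p < 1"
    and bal1: "\<beta> + \<gamma> + \<delta> = 2 * \<alpha> + h" and bal2: "\<epsilon> + \<phi> = \<alpha> + (of_nat n + 1) * h"
    and nz: "odd_theta p \<alpha> \<noteq> 0" "odd_theta p (\<alpha> - (of_nat n + 1) * h) \<noteq> 0"
    and nz1: "\<And>k. k \<le> n \<Longrightarrow> add_poch (odd_theta p) h (\<alpha> + h - \<beta>) k * add_poch (odd_theta p) h (\<alpha> + h - \<gamma>) k
        * add_poch (odd_theta p) h (\<alpha> + h - \<delta>) k \<noteq> 0"
    and nz2: "\<And>k. k \<le> n \<Longrightarrow> add_poch (odd_theta p) (2 * h) (\<alpha> + 2 * h - \<epsilon>) k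
        * add_poch (odd_theta p) (2 * h) (\<alpha> + 2 * h - \<phi>) k * add_poch (odd_theta p) (2 * h) (\<alpha> + (of_nat n + 2) * h) k \<noteq> 0"
    and nz3: "add_poch (odd_theta p) h (\<alpha> + h - \<beta>) n * add_poch (odd_theta p) h (\<alpha> + h - \<gamma>) n
        * (add_poch (odd_theta p) (2 * h) (\<alpha> + (1 - of_nat n) * h) n * add_poch (odd_theta p) (2 * h) (\<delta> - \<alpha> - of_nat n * h) n) \<noteq> 0"
    and nz4: "\<And>j. j \<le> n div 2 \<Longrightarrow> add_poch (odd_theta p) (2 * h) (2 * h) j * add_poch (odd_theta p) (2 * h) (\<alpha> + (1 - of_nat n) * h - \<beta>) j
          * add_poch (odd_theta p) (2 * h) (\<alpha> + (1 - of_nat n) * h - \<gamma>) j * add_poch (odd_theta p) (2 * h) (\<alpha> + (1 - of_nat n) * h - \<delta>) j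
          * add_poch (odd_theta p) (2 * h) (\<alpha> + 2 * h - \<phi>) j * add_poch (odd_theta p) (2 * h) (\<alpha> + 2 * h - \<epsilon>) j
          * add_poch (odd_theta p) (2 * h) \<alpha> j * add_poch (odd_theta p) (2 * h) (\<alpha> + h) j \<noteq> 0"
  shows "(\<Sum>k\<le>n. quad_summand (odd_theta p) h \<alpha> \<beta> \<gamma> \<delta> \<epsilon> \<phi> n k)
    = quad_prefactor (odd_theta p) h \<alpha> \<beta> \<gamma> \<delta> n * (\<Sum>j\<le>n div 2. quad_omega_summand (odd_theta p) h \<alpha> \<beta> \<gamma> \<delta> \<epsilon> \<phi> n j)"
proof -
  interpret odd_Weierstrass "odd_theta p" by (rule odd_Weierstrass_odd_theta[OF p])
  \<comment> \<open>With \<open>\<beta>\<close> and \<open>\<gamma>\<close> at rest, the balancing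
    conditions force the speed \<open>5 = 2 + 3\<close> of \<open>\<delta>\<close> and the speed
    \<open>2 + 3 * n = 1 + 3 * (n + 1) - 2\<close> of \<open>\<phi>\<close>.\<close>
  define H where "H = (\<lambda>z::complex. h + 3 * z)"
  define \<alpha>' where "\<alpha>' = (\<lambda>z::complex. \<alpha> + z)"
  define \<delta>' where "\<delta>' = (\<lambda>z::complex. \<delta> + 5 * z)"
  define \<epsilon>' where "\<epsilon>' = (\<lambda>z::complex. \<epsilon> + 2 * z)"
  define \<phi>' where "\<phi>' = (\<lambda>z::complex. \<phi> + (2 + 3 * of_nat n) * z)"
  have at0: "H 0 = h" "\<alpha>' 0 = \<alpha>" "\<delta>' 0 = \<delta>" "\<epsilon>' 0 = \<epsilon>" "\<phi>' 0 = \<phi>"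
    by (simp_all add: H_def \<alpha>'_def \<delta>'_def \<epsilon>'_def \<phi>'_def)
  have cont: "isCont H 0" "isCont \<alpha>' 0" "isCont \<delta>' 0" "isCont \<epsilon>' 0" "isCont \<phi>' 0"
    unfolding H_def \<alpha>'_def \<delta>'_def \<epsilon>'_def \<phi>'_def
    by (intro isCont_add isCont_mult continuous_ident continuous_const)+
  note cont_rules = isCont_divide isCont_mult isCont_add isCont_diff isCont_minus isCont_odd_theta_compose[OF p]
    isCont_add_poch_compose[OF p] continuous_const cont
  define Z where "Z x c = {z. odd_theta p (x + c * z) = 0}" for x c
  define S where "S = (\<Union>i\<in>- {0}. Z (of_int i * h) (3 * of_int i)) \<union> (\<Union>i. Z (\<alpha> + of_int i * h) (of_int (1 + 3 * i)))
    \<union> (\<Union>i. Z (\<alpha> - \<delta> + of_int i * h) (of_int (3 * i - 4))) \<union> (\<Union>i. Z (\<alpha> - \<beta> + of_int i * h) (of_int (1 + 3 * i)))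
    \<union> (\<Union>i. Z (\<alpha> - \<gamma> + of_int i * h) (of_int (1 + 3 * i))) \<union> (\<Union>i. Z (\<alpha> - \<epsilon> + of_int i * h) (of_int (3 * i - 1)))
    \<union> (\<Union>i. Z (\<epsilon> + of_int i * h) (of_int (2 + 3 * i)))"
  have Z: "countable (Z x c)" if "c \<noteq> 0" for x c
    unfolding Z_def by (rule countable_odd_theta_affine_zeros[OF p that])
  \<comment> \<open>Multiples of \<open>h\<close> have speeds divisible by 3, whereas the speeds 1,
    -4, -1 and 2 of the other combinations are not; so no sum is at rest.\<close>
  have c: "of_int (1 + 3 * i) \<noteq> (0 :: complex)" "of_int (3 * i - 4) \<noteq> (0 :: complex)"
      "of_int (3 * i - 1) \<noteq> (0 :: complex)" "of_int (2 + 3 * i) \<noteq> (0 :: complex)" for i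
    unfolding of_int_eq_0_iff by presburger+
  have "countable (\<Union>i\<in>- {0}. Z (of_int i * h) (3 * of_int i))"
    by (intro countable_UN Z) simp_all
  then have "countable S"
    unfolding S_def by (intro countable_Un countable_UN Z c) simp_all
  have "(\<Sum>k\<le>n. quad_summand (odd_theta p) (H 0) (\<alpha>' 0) \<beta> \<gamma> (\<delta>' 0) (\<epsilon>' 0) (\<phi>' 0) n k)
    = quad_prefactor (odd_theta p) (H 0) (\<alpha>' 0) \<beta> \<gamma> (\<delta>' 0) n
      * (\<Sum>j\<le>n div 2. quad_omega_summand (odd_theta p) (H 0) (\<alpha>' 0) \<beta> \<gamma> (\<delta>' 0) (\<epsilon>' 0) (\<phi>' 0) n j)"
  proof (rule continuous_eq_off_countable[OF _ _ \<open>countable S\<close>,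
        where f = "\<lambda>z. \<Sum>k\<le>n. quad_summand (odd_theta p) (H z) (\<alpha>' z) \<beta> \<gamma> (\<delta>' z) (\<epsilon>' z) (\<phi>' z) n k"
        and g = "\<lambda>z. quad_prefactor (odd_theta p) (H z) (\<alpha>' z) \<beta> \<gamma> (\<delta>' z) n
      * (\<Sum>j\<le>n div 2. quad_omega_summand (odd_theta p) (H z) (\<alpha>' z) \<beta> \<gamma> (\<delta>' z) (\<epsilon>' z) (\<phi>' z) n j)"])
    show "isCont (\<lambda>z. \<Sum>k\<le>n. quad_summand (odd_theta p) (H z) (\<alpha>' z) \<beta> \<gamma> (\<delta>' z) (\<epsilon>' z) (\<phi>' z) n k) 0"
    proof (rule continuous_sum)
      fix k assume "k \<in> {..n}"
      then have k: "k \<le> n" by simp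
      note d = nz(1)[folded at0] nz1[OF k, folded at0] nz2[OF k, folded at0]
      show "isCont (\<lambda>z. quad_summand (odd_theta p) (H z) (\<alpha>' z) \<beta> \<gamma> (\<delta>' z) (\<epsilon>' z) (\<phi>' z) n k) 0"
        unfolding quad_summand_def by (intro cont_rules d)
    qed
    show "isCont (\<lambda>z. quad_prefactor (odd_theta p) (H z) (\<alpha>' z) \<beta> \<gamma> (\<delta>' z) n
      * (\<Sum>j\<le>n div 2. quad_omega_summand (odd_theta p) (H z) (\<alpha>' z) \<beta> \<gamma> (\<delta>' z) (\<epsilon>' z) (\<phi>' z) n j)) 0"
    proof (intro isCont_mult continuous_sum)
      note d = nz3[folded at0]
      show "isCont (\<lambda>z. quad_prefactor (odd_theta p) (H z) (\<alpha>' z) \<beta> \<gamma> (\<delta>' z) n) 0"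
        unfolding quad_prefactor_def by (intro cont_rules d)
    next
      fix j assume "j \<in> {..n div 2}"
      then have j: "j \<le> n div 2" by simp
      note d = nz(2)[folded at0] nz4[OF j, folded at0]
      show "isCont (\<lambda>z. quad_omega_summand (odd_theta p) (H z) (\<alpha>' z) \<beta> \<gamma> (\<delta>' z) (\<epsilon>' z) (\<phi>' z) n j) 0"
        unfolding quad_omega_summand_def by (intro cont_rules d)
    qed
    fix z assume "z \<notin> S"
    then have gen: "i \<noteq> 0 \<Longrightarrow> odd_theta p (of_int i * h + 3 * of_int i * z) \<noteq> 0"
      "odd_theta p (\<alpha> + of_int i * h + of_int (1 + 3 * i) * z) \<noteq> 0"
      "odd_theta p (\<alpha> - \<delta> + of_int i * h + of_int (3 * i - 4) * z) \<noteq> 0"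
      "odd_theta p (\<alpha> - \<beta> + of_int i * h + of_int (1 + 3 * i) * z) \<noteq> 0"
      "odd_theta p (\<alpha> - \<gamma> + of_int i * h + of_int (1 + 3 * i) * z) \<noteq> 0"
      "odd_theta p (\<alpha> - \<epsilon> + of_int i * h + of_int (3 * i - 1) * z) \<noteq> 0"
      "odd_theta p (\<epsilon> + of_int i * h + of_int (2 + 3 * i) * z) \<noteq> 0" for i
      unfolding S_def by (simp_all add: Z_def)
    have e: "of_int i * h + 3 * of_int i * z = of_int i * H z"
      "\<alpha> + of_int i * h + of_int (1 + 3 * i) * z = \<alpha>' z + of_int i * H z"
      "\<alpha> - \<delta> + of_int i * h + of_int (3 * i - 4) * z = \<alpha>' z - \<delta>' z + of_int i * H z"
      "\<alpha> - \<beta> + of_int i * h + of_int (1 + 3 * i) * z = \<alpha>' z - \<beta> + of_int i * H z"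
      "\<alpha> - \<gamma> + of_int i * h + of_int (1 + 3 * i) * z = \<alpha>' z - \<gamma> + of_int i * H z"
      "\<alpha> - \<epsilon> + of_int i * h + of_int (3 * i - 1) * z = \<alpha>' z - \<epsilon>' z + of_int i * H z"
      "\<epsilon> + of_int i * h + of_int (2 + 3 * i) * z = \<epsilon>' z + of_int i * H z" for i
      by (simp_all add: H_def \<alpha>'_def \<delta>'_def \<epsilon>'_def algebra_simps)
    note gen = gen[unfolded e]
    have "quad_generic (H z) (\<alpha>' z) (\<delta>' z)"
      unfolding quad_generic_def using gen by blast
    moreover have "\<beta> + \<gamma> + \<delta>' z = 2 * \<alpha>' z + H z"
      using bal1 by (simp add: H_def \<alpha>'_def \<delta>'_def algebra_simps)
    moreover have "\<epsilon>' z + \<phi>' z = \<alpha>' z + (of_nat n + 1) * H z"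
      using bal2 by (simp add: H_def \<alpha>'_def \<epsilon>'_def \<phi>'_def algebra_simps)
    ultimately show "(\<Sum>k\<le>n. quad_summand (odd_theta p) (H z) (\<alpha>' z) \<beta> \<gamma> (\<delta>' z) (\<epsilon>' z) (\<phi>' z) n k)
      = quad_prefactor (odd_theta p) (H z) (\<alpha>' z) \<beta> \<gamma> (\<delta>' z) n
      * (\<Sum>j\<le>n div 2. quad_omega_summand (odd_theta p) (H z) (\<alpha>' z) \<beta> \<gamma> (\<delta>' z) (\<epsilon>' z) (\<phi>' z) n j)"
      by (rule quadratic_transformation_generic) (rule gen)+
  qed
  then show ?thesis unfolding at0 .
qed

section \<open>From additive to multiplicative notation\<close>

text \<open>This is the sum of \<open>(x + i * h) / 2\<close> over \<open>i < n\<close>. In closed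
  form, the cancellation of exponents becomes a polynomial identity.\<close>

definition add_poch_weight :: "complex \<Rightarrow> complex \<Rightarrow> nat \<Rightarrow> complex" where
  "add_poch_weight h x n = of_nat n * (2 * x + (of_nat n - 1) * h) / 4"

lemma Etheta_exp: "Etheta p (exp w) = exp (w / 2) * odd_theta p w"
  by (simp add: odd_theta_def exp_minus)

lemma tpoch_exp: "tpoch p (exp h) (exp x) (int n) = exp (add_poch_weight h x n) * add_poch (odd_theta p) h x n"
proof (induction n)
  case 0
  then show ?case by (simp add: tpoch_def add_poch_weight_def)
next
  case (Suc n)
  have e: "exp x * exp h ^ n = exp (x + of_nat n * h)"
    by (simp add: exp_add exp_of_nat_mult)
  have w: "add_poch_weight h x (Suc n) = add_poch_weight h x n + (x + of_nat n * h) / 2"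
    by (simp add: add_poch_weight_def field_simps)
  have "tpoch p (exp h) (exp x) (int (Suc n)) = tpoch p (exp h) (exp x) (int n) * Etheta p (exp (x + of_nat n * h))"
    unfolding e[symmetric] by (simp add: tpoch_def nat_add_distrib del: of_nat_Suc)
  also have "\<dots> = exp (add_poch_weight h x n) * add_poch (odd_theta p) h x n
      * (exp ((x + of_nat n * h) / 2) * odd_theta p (x + of_nat n * h))"
    by (simp only: Suc.IH Etheta_exp)
  also have "\<dots> = exp (add_poch_weight h x (Suc n)) * add_poch (odd_theta p) h x (Suc n)"
    unfolding w exp_add[of "add_poch_weight h x n"] add_poch_Suc by (simp only: mult_ac)
  finally show ?case .
qed

lemma tpochs_exp:
  "tpochs p (exp h) (map exp xs) (int n)
    = exp (\<Sum>x\<leftarrow>xs. add_poch_weight h x n) * (\<Prod>x\<leftarrow>xs. add_poch (odd_theta p) h x n)"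
proof -
  have "tpochs p (exp h) (map exp xs) (int n) = (\<Prod>x\<leftarrow>xs. tpoch p (exp h) (exp x) (int n))"
    by (simp add: tpochs_def o_def)
  also have "\<dots> = exp (\<Sum>x\<leftarrow>xs. add_poch_weight h x n) * (\<Prod>x\<leftarrow>xs. add_poch (odd_theta p) h x n)"
    by (induction xs) (simp_all add: tpoch_exp exp_add)
  finally show ?thesis .
qed

text \<open>Shaped after a summand of the left-hand side, with \<open>exp e5\<close> for
  \<open>q ^ k\<close>. The balancing conditions are what makes the exponents cancel.\<close>

lemma cancel_exp_weights:
  fixes X0 :: complex
  assumes "e0 - f0 + e1 - e2 + e3 - e4 + e5 = 0"
  shows "exp e0 * X0 / (exp f0 * Y0) * (exp e1 * X1) / (exp e2 * X2) * (exp e3 * X3) / (exp e4 * X4) * exp e5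
    = X0 / Y0 * X1 / X2 * X3 / X4"
proof -
  have "exp e0 * X0 / (exp f0 * Y0) * (exp e1 * X1) / (exp e2 * X2) * (exp e3 * X3) / (exp e4 * X4) * exp e5
    = exp (e0 - f0 + e1 - e2 + e3 - e4 + e5) * (X0 / Y0 * X1 / X2 * X3 / X4)"
    by (simp add: exp_add exp_diff mult_ac)
  with assms show ?thesis by simp
qed

text \<open>Genericity appears as nonvanishing of the denominators, for the series up to the index
  \<open>n div 2\<close>, after which a numerator factor is zero.\<close>

theorem theorem4p7:
  fixes p q a b c d e f :: complex and n :: nat
  assumes hp: "norm p < 1"
    and hnz: "q \<noteq> 0" "a \<noteq> 0" "b \<noteq> 0" "c \<noteq> 0" "d \<noteq> 0" "e \<noteq> 0" "f \<noteq> 0"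
    and hbal1: "b * c * d = a ^ 2 * q"
    and hbal2: "e * f = a * q ^ (n + 1)"
    and gen_lhs0: "Etheta p a \<noteq> 0"
    and gen_lhs1: "\<forall>k\<le>n. tpochs p q [a * q / b, a * q / c, a * q / d] (int k) \<noteq> 0"
    and gen_lhs2: "\<forall>k\<le>n. tpochs p (q ^ 2) [a * q ^ 2 / e, a * q ^ 2 / f, a * q ^ (n + 2)] (int k) \<noteq> 0"
    and gen_rhs1: "tpochs p q [a * q / b, a * q / c] (int n) \<noteq> 0"
    and gen_rhs2: "tpochs p (q ^ 2) [a * q powi (1 - int n), a * q powi (1 - int n) / (b * c)] (int n) \<noteq> 0"
    and gen_om0: "Etheta p (a ^ 2 / (e * f)) \<noteq> 0"
    and gen_om1: "\<forall>k\<le>n div 2. tpochs p (q ^ 2)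
        (q ^ 2 # map (\<lambda>ai. a ^ 2 / (e * f) * q ^ 2 / ai)
           [b, c, d, a / e, a / f, q powi (1 - int n), q powi (- int n)]) (int k) \<noteq> 0"
  shows "(\<Sum>k\<le>n. Etheta p (a * q ^ (3 * k)) / Etheta p a
            * tpochs p (q ^ 2) [b, c, d] (int k) / tpochs p q [a * q / b, a * q / c, a * q / d] (int k)
            * tpochs p q [e, f, q powi (- int n)] (int k)
            / tpochs p (q ^ 2) [a * q ^ 2 / e, a * q ^ 2 / f, a * q ^ (n + 2)] (int k)
            * q ^ k)
       = tpochs p q [a * q, a * q / (b * c)] (int n)
           * tpochs p (q ^ 2) [a * q powi (1 - int n) / b, a * q powi (1 - int n) / c] (int n)
         / (tpochs p q [a * q / b, a * q / c] (int n)
           * tpochs p (q ^ 2) [a * q powi (1 - int n), a * q powi (1 - int n) / (b * c)] (int n))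
         * omega p (q ^ 2) (a ^ 2 / (e * f))
             [b, c, d, a / e, a / f, q powi (1 - int n), q powi (- int n)]"
proof -
  interpret odd_Weierstrass "odd_theta p" by (rule odd_Weierstrass_odd_theta[OF hp])
  define N where "N = (of_nat n :: complex)"
  define h \<alpha> \<beta> \<gamma> \<epsilon> where "h = Ln q" and "\<alpha> = Ln a" and "\<beta> = Ln b" and "\<gamma> = Ln c" and "\<epsilon> = Ln e"
  \<comment> \<open>\<open>\<delta>\<close> and \<open>\<phi>\<close> are defined by the balancing
    conditions instead of as \<open>Ln d\<close> and \<open>Ln f\<close>, which might miss them by a
    multiple of \<open>2 * pi * \<i>\<close>.\<close>
  define \<delta> where "\<delta> = 2 * \<alpha> + h - \<beta> - \<gamma>"
  define \<phi> where "\<phi> = \<alpha> + (N + 1) * h - \<epsilon>"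
  define \<mu> where "\<mu> = \<alpha> - (N + 1) * h"
  have ex [simp]: "exp h = q" "exp \<alpha> = a" "exp \<beta> = b" "exp \<gamma> = c" "exp \<epsilon> = e"
    using hnz by (simp_all add: h_def \<alpha>_def \<beta>_def \<gamma>_def \<epsilon>_def)
  have q2 [simp]: "exp (2 * h) = q ^ 2" "exp (2 * \<alpha>) = a ^ 2" by (simp_all add: exp_double)
  have qn [simp]: "exp (N * h) = q ^ n" unfolding N_def by (simp add: exp_of_nat_mult)
  have qN [simp]: "exp ((N + 1) * h) = q ^ (n + 1)" by (simp add: distrib_right exp_add)
  have qN2: "exp ((N + 2) * h) = q ^ (n + 2)"
    by (simp only: distrib_right exp_add qn q2 power_add)
  have d [simp]: "exp \<delta> = d"
    unfolding \<delta>_def exp_diff exp_add[of "2 * \<alpha>" h] ex q2 using hbal1 hnz by (simp add: field_simps)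
  have f [simp]: "exp \<phi> = f"
    unfolding \<phi>_def exp_diff exp_add[of \<alpha>] ex qN using hbal2 hnz by (simp add: field_simps)
  have qm: "q powi (- int n) = exp (- N * h)" "q powi (1 - int n) = exp ((1 - N) * h)"
    using hnz by (simp_all add: power_int_minus power_int_diff exp_minus exp_diff left_diff_distrib inverse_eq_divide)
  have \<mu>: "a ^ 2 / (e * f) = exp \<mu>"
    unfolding power2_eq_square[of a] hbal2 \<mu>_def exp_diff ex qN
    by (rule mult_divide_mult_cancel_left) (rule hnz)
  have Tq: "tpochs p q (map exp xs) (int k) = exp (\<Sum>x\<leftarrow>xs. add_poch_weight h x k) * (\<Prod>x\<leftarrow>xs. add_poch (odd_theta p) h x k)"
    for xs k using tpochs_exp[of p h] by simp
  have Tq2: "tpochs p (q ^ 2) (map exp xs) (int k)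
      = exp (\<Sum>x\<leftarrow>xs. add_poch_weight (2 * h) x k) * (\<Prod>x\<leftarrow>xs. add_poch (odd_theta p) (2 * h) x k)"
    for xs k using tpochs_exp[of p "2 * h"] by simp

  have args1: "[b, c, d] = map exp [\<beta>, \<gamma>, \<delta>]"
    "[a * q / b, a * q / c, a * q / d] = map exp [\<alpha> + h - \<beta>, \<alpha> + h - \<gamma>, \<alpha> + h - \<delta>]"
    "[e, f, exp (- N * h)] = map exp [\<epsilon>, \<phi>, - N * h]"
    "[a * q ^ 2 / e, a * q ^ 2 / f, a * q ^ (n + 2)] = map exp [\<alpha> + 2 * h - \<epsilon>, \<alpha> + 2 * h - \<phi>, \<alpha> + (N + 2) * h]"
    by (simp_all only: list.map exp_add exp_diff ex q2 qN2 d f)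
  have args2: "[a * q, a * q / (b * c)] = map exp [\<alpha> + h, \<delta> - \<alpha>]"
    "[a * exp ((1 - N) * h) / b, a * exp ((1 - N) * h) / c] = map exp [\<alpha> + (1 - N) * h - \<beta>, \<alpha> + (1 - N) * h - \<gamma>]"
    "[a * q / b, a * q / c] = map exp [\<alpha> + h - \<beta>, \<alpha> + h - \<gamma>]"
    "[a * exp ((1 - N) * h), a * exp ((1 - N) * h) / (b * c)] = map exp [\<alpha> + (1 - N) * h, \<delta> - \<alpha> - N * h]"
  proof -
    have "\<delta> - \<alpha> = \<alpha> + h - \<beta> - \<gamma>" "\<delta> - \<alpha> - N * h = \<alpha> + (1 - N) * h - \<beta> - \<gamma>"
      by (simp_all add: \<delta>_def algebra_simps)
    then have "exp (\<delta> - \<alpha>) = a * q / (b * c)" "exp (\<delta> - \<alpha> - N * h) = a * exp ((1 - N) * h) / (b * c)"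
      by (simp_all only: exp_diff exp_add ex divide_divide_eq_left)
    then show "[a * q, a * q / (b * c)] = map exp [\<alpha> + h, \<delta> - \<alpha>]"
      "[a * exp ((1 - N) * h), a * exp ((1 - N) * h) / (b * c)] = map exp [\<alpha> + (1 - N) * h, \<delta> - \<alpha> - N * h]"
      by (simp_all only: list.map exp_add ex)
  qed (simp_all only: list.map exp_add exp_diff ex)
  have args3: "exp \<mu> # [b, c, d, a / e, a / f, exp ((1 - N) * h), exp (- N * h)]
      = map exp [\<mu>, \<beta>, \<gamma>, \<delta>, \<alpha> - \<epsilon>, \<alpha> - \<phi>, (1 - N) * h, - N * h]"
    by (simp only: list.map exp_diff ex d f)
  have args4: "q ^ 2 # map (\<lambda>ai. exp \<mu> * q ^ 2 / ai) [b, c, d, a / e, a / f, exp ((1 - N) * h), exp (- N * h)]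
      = map exp [2 * h, \<alpha> + (1 - N) * h - \<beta>, \<alpha> + (1 - N) * h - \<gamma>, \<alpha> + (1 - N) * h - \<delta>,
          \<alpha> + 2 * h - \<phi>, \<alpha> + 2 * h - \<epsilon>, \<alpha>, \<alpha> + h]"
  proof -
    \<comment> \<open>Every entry rests on \<open>\<mu> + 2 * h = \<alpha> + (1 - N) * h\<close>;
      the condition on \<open>ef\<close> is what exchanges \<open>e\<close> and
      \<open>f\<close>.\<close>
    have "\<alpha> + (1 - N) * h - x = \<mu> + 2 * h - x" "\<alpha> + 2 * h - \<phi> = \<mu> + 2 * h - (\<alpha> - \<epsilon>)"
      "\<alpha> + 2 * h - \<epsilon> = \<mu> + 2 * h - (\<alpha> - \<phi>)" "\<alpha> = \<mu> + 2 * h - (1 - N) * h"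
      "\<alpha> + h = \<mu> + 2 * h - - N * h" for x
      by (simp_all add: \<mu>_def \<phi>_def algebra_simps)
    then have "exp (\<alpha> + (1 - N) * h - \<beta>) = exp \<mu> * q ^ 2 / b" "exp (\<alpha> + (1 - N) * h - \<gamma>) = exp \<mu> * q ^ 2 / c"
      "exp (\<alpha> + (1 - N) * h - \<delta>) = exp \<mu> * q ^ 2 / d"
      "exp (\<alpha> + 2 * h - \<phi>) = exp \<mu> * q ^ 2 / (a / e)" "exp (\<alpha> + 2 * h - \<epsilon>) = exp \<mu> * q ^ 2 / (a / f)"
      "exp \<alpha> = exp \<mu> * q ^ 2 / exp ((1 - N) * h)" "exp (\<alpha> + h) = exp \<mu> * q ^ 2 / exp (- N * h)"
      by (metis exp_diff exp_add ex d f q2)+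
    then show ?thesis by (simp only: list.map q2)
  qed

  have Ea: "Etheta p (a * q ^ (3 * k)) = exp ((\<alpha> + 3 * of_nat k * h) / 2) * odd_theta p (\<alpha> + 3 * of_nat k * h)"
      "Etheta p a = exp (\<alpha> / 2) * odd_theta p \<alpha>" for k
  proof -
    have "a * q ^ (3 * k) = exp (\<alpha> + 3 * of_nat k * h)"
      using exp_of_nat_mult[of "3 * k" h] by (simp add: exp_add)
    then show "Etheta p (a * q ^ (3 * k)) = exp ((\<alpha> + 3 * of_nat k * h) / 2) * odd_theta p (\<alpha> + 3 * of_nat k * h)"
      by (simp only: Etheta_exp)
    show "Etheta p a = exp (\<alpha> / 2) * odd_theta p \<alpha>" using Etheta_exp[of p \<alpha>] by simp
  qed
  have E\<mu>: "Etheta p (exp \<mu> * (q ^ 2) ^ (2 * k)) = exp ((\<mu> + 4 * of_nat k * h) / 2) * odd_theta p (\<mu> + 4 * of_nat k * h)"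
      "Etheta p (exp \<mu>) = exp (\<mu> / 2) * odd_theta p \<mu>" for k
  proof -
    have "exp \<mu> * (q ^ 2) ^ (2 * k) = exp (\<mu> + 4 * of_nat k * h)"
      using exp_of_nat_mult[of "4 * k" h] by (simp add: exp_add flip: power_mult)
    then show "Etheta p (exp \<mu> * (q ^ 2) ^ (2 * k)) = exp ((\<mu> + 4 * of_nat k * h) / 2) * odd_theta p (\<mu> + 4 * of_nat k * h)"
      by (simp only: Etheta_exp)
  qed (rule Etheta_exp)

  have L: "Etheta p (a * q ^ (3 * k)) / Etheta p a
            * tpochs p (q ^ 2) [b, c, d] (int k) / tpochs p q [a * q / b, a * q / c, a * q / d] (int k)
            * tpochs p q [e, f, q powi (- int n)] (int k)
            / tpochs p (q ^ 2) [a * q ^ 2 / e, a * q ^ 2 / f, a * q ^ (n + 2)] (int k)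
            * q ^ k = quad_summand (odd_theta p) h \<alpha> \<beta> \<gamma> \<delta> \<epsilon> \<phi> n k" for k
  proof -
    have qk: "q ^ k = exp (of_nat k * h)" by (simp add: exp_of_nat_mult)
    show ?thesis
      unfolding qm args1 Tq Tq2 Ea qk
      by (subst cancel_exp_weights)
        (simp_all add: add_poch_weight_def \<delta>_def \<phi>_def quad_summand_def N_def mult.assoc, simp add: field_simps)
  qed
  have R: "tpochs p q [a * q, a * q / (b * c)] (int n)
           * tpochs p (q ^ 2) [a * q powi (1 - int n) / b, a * q powi (1 - int n) / c] (int n)
         / (tpochs p q [a * q / b, a * q / c] (int n)
           * tpochs p (q ^ 2) [a * q powi (1 - int n), a * q powi (1 - int n) / (b * c)] (int n))
      = quad_prefactor (odd_theta p) h \<alpha> \<beta> \<gamma> \<delta> n"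
  proof -
    have w: "(\<Sum>x\<leftarrow>[\<alpha> + h, \<delta> - \<alpha>]. add_poch_weight h x n)
        - (\<Sum>x\<leftarrow>[\<alpha> + h - \<beta>, \<alpha> + h - \<gamma>]. add_poch_weight h x n) = 0"
      "(\<Sum>x\<leftarrow>[\<alpha> + (1 - N) * h - \<beta>, \<alpha> + (1 - N) * h - \<gamma>]. add_poch_weight (2 * h) x n)
        - (\<Sum>x\<leftarrow>[\<alpha> + (1 - N) * h, \<delta> - \<alpha> - N * h]. add_poch_weight (2 * h) x n) = 0"
      by (simp_all add: add_poch_weight_def \<delta>_def) (simp_all add: field_simps)
    have c: "exp e1 * X1 * (exp e2 * X2) / (exp e3 * X3 * (exp e4 * X4)) = X1 * X2 / (X3 * X4)"
      if "e1 - e3 = 0" "e2 - e4 = 0" for e1 e2 e3 e4 X1 X2 X3 X4 :: complex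
      using that by simp
    show ?thesis
      unfolding qm args2 Tq Tq2 c[OF w] quad_prefactor_def N_def[symmetric] by (simp add: mult.assoc)
  qed
  have O: "omega p (q ^ 2) (a ^ 2 / (e * f)) [b, c, d, a / e, a / f, q powi (1 - int n), q powi (- int n)]
      = (\<Sum>j\<le>n div 2. quad_omega_summand (odd_theta p) h \<alpha> \<beta> \<gamma> \<delta> \<epsilon> \<phi> n j)"
  proof -
    define t where "t k = Etheta p (exp \<mu> * (q ^ 2) ^ (2 * k)) / Etheta p (exp \<mu>)
        * tpochs p (q ^ 2) (exp \<mu> # [b, c, d, a / e, a / f, exp ((1 - N) * h), exp (- N * h)]) (int k) * (q ^ 2) ^ k
        / tpochs p (q ^ 2) (q ^ 2 # map (\<lambda>ai. exp \<mu> * q ^ 2 / ai) [b, c, d, a / e, a / f, exp ((1 - N) * h), exp (- N * h)]) (int k)"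
      for k
    have t: "t k = quad_omega_summand (odd_theta p) h \<alpha> \<beta> \<gamma> \<delta> \<epsilon> \<phi> n k" for k
    proof -
      have qk: "(q ^ 2) ^ k = exp (2 * of_nat k * h)"
        using exp_of_nat_mult[of "2 * k" h] by (simp flip: power_mult)
      have w: "(\<mu> + 4 * of_nat k * h) / 2 - \<mu> / 2
          + (\<Sum>x\<leftarrow>[\<mu>, \<beta>, \<gamma>, \<delta>, \<alpha> - \<epsilon>, \<alpha> - \<phi>, (1 - N) * h, - N * h]. add_poch_weight (2 * h) x k)
          + 2 * of_nat k * h
          - (\<Sum>x\<leftarrow>[2 * h, \<alpha> + (1 - N) * h - \<beta>, \<alpha> + (1 - N) * h - \<gamma>, \<alpha> + (1 - N) * h - \<delta>,
              \<alpha> + 2 * h - \<phi>, \<alpha> + 2 * h - \<epsilon>, \<alpha>, \<alpha> + h]. add_poch_weight (2 * h) x k) = 0"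
        by (simp add: add_poch_weight_def \<delta>_def \<phi>_def \<mu>_def) (simp add: field_simps)
      have c: "exp e0 * X0 / (exp f0 * Y0) * (exp e1 * X1) * exp e2 / (exp e3 * X3) = X0 / Y0 * X1 / X3"
        if "e0 - f0 + e1 + e2 - e3 = 0" for e0 f0 e1 e2 e3 X0 Y0 X1 X3 :: complex
      proof -
        have "exp e0 * X0 / (exp f0 * Y0) * (exp e1 * X1) * exp e2 / (exp e3 * X3)
          = exp (e0 - f0 + e1 + e2 - e3) * (X0 / Y0 * X1 / X3)"
          by (simp add: exp_add exp_diff mult_ac)
        with that show ?thesis by simp
      qed
      show ?thesis
        unfolding t_def args3 args4 Tq2 E\<mu> qk c[OF w] unfolding quad_omega_summand_def N_def[symmetric] \<mu>_def
        by (simp add: mult.assoc)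
    qed
    have "omega p (q ^ 2) (a ^ 2 / (e * f)) [b, c, d, a / e, a / f, q powi (1 - int n), q powi (- int n)] = suminf t"
      unfolding omega_def qm \<mu> t_def ..
    also have "\<dots> = (\<Sum>k\<in>{..n div 2}. t k)"
    proof (rule suminf_finite)
      fix k assume "k \<notin> {..n div 2}"
      then have k: "n div 2 < k" by simp
      have z: "add_poch (odd_theta p) (2 * h) x k = 0" if "x = - (of_nat i * (2 * h))" "i < k" for x i
        unfolding add_poch_def using that s_0 by (intro prod_zero) (auto intro!: bexI[of _ i])
      have "add_poch (odd_theta p) (2 * h) ((1 - N) * h) k = 0 \<or> add_poch (odd_theta p) (2 * h) (- N * h) k = 0"
      \<comment> \<open>The parity of \<open>n\<close> decides which of the two parameters is a
        nonpositive multiple of \<open>2 * h\<close>; in both cases the vanishing factor has index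
        \<open>n div 2\<close>.\<close>
      proof (cases "even n")
        case True
        then obtain i where "n = 2 * i" by blast
        then show ?thesis using k z[of "- N * h" i] by (simp add: N_def)
      next
        case False
        then obtain i where "n = 2 * i + 1" by (rule oddE)
        then show ?thesis using k z[of "(1 - N) * h" i] by (simp add: N_def)
      qed
      \<comment> \<open>The numerator is zero, so the quotient is zero whatever the denominator, as
        \<open>0 / 0 = 0\<close>.\<close>
      then show "t k = 0" unfolding t quad_omega_summand_def N_def by auto
    qed simp
    finally show ?thesis unfolding t .
  qed
  show ?thesis
    unfolding L R O
  proof (rule quadratic_transformation_odd_theta[OF hp])
    show "\<beta> + \<gamma> + \<delta> = 2 * \<alpha> + h" "\<epsilon> + \<phi> = \<alpha> + (of_nat n + 1) * h"
      by (simp_all add: \<delta>_def \<phi>_def N_def)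
    show "odd_theta p \<alpha> \<noteq> 0" "odd_theta p (\<alpha> - (of_nat n + 1) * h) \<noteq> 0"
      using gen_lhs0 gen_om0 Etheta_exp[of p \<alpha>] Etheta_exp[of p \<mu>] unfolding \<mu> by (auto simp: \<mu>_def N_def)
  next
    fix k assume "k \<le> n"
    then show "add_poch (odd_theta p) h (\<alpha> + h - \<beta>) k * add_poch (odd_theta p) h (\<alpha> + h - \<gamma>) k
        * add_poch (odd_theta p) h (\<alpha> + h - \<delta>) k \<noteq> 0"
      using gen_lhs1 unfolding args1 Tq by simp
  next
    fix k assume "k \<le> n"
    then show "add_poch (odd_theta p) (2 * h) (\<alpha> + 2 * h - \<epsilon>) k
        * add_poch (odd_theta p) (2 * h) (\<alpha> + 2 * h - \<phi>) k * add_poch (odd_theta p) (2 * h) (\<alpha> + (of_nat n + 2) * h) k \<noteq> 0"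
      using gen_lhs2 unfolding args1 Tq2 N_def[symmetric] by simp
  next
    show "add_poch (odd_theta p) h (\<alpha> + h - \<beta>) n * add_poch (odd_theta p) h (\<alpha> + h - \<gamma>) n
        * (add_poch (odd_theta p) (2 * h) (\<alpha> + (1 - of_nat n) * h) n * add_poch (odd_theta p) (2 * h) (\<delta> - \<alpha> - of_nat n * h) n) \<noteq> 0"
      using gen_rhs1 gen_rhs2 unfolding qm args2 Tq Tq2 N_def[symmetric] by simp
  next
    fix j assume "j \<le> n div 2"
    then show "add_poch (odd_theta p) (2 * h) (2 * h) j * add_poch (odd_theta p) (2 * h) (\<alpha> + (1 - of_nat n) * h - \<beta>) j
          * add_poch (odd_theta p) (2 * h) (\<alpha> + (1 - of_nat n) * h - \<gamma>) j * add_poch (odd_theta p) (2 * h) (\<alpha> + (1 - of_nat n) * h - \<delta>) j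
          * add_poch (odd_theta p) (2 * h) (\<alpha> + 2 * h - \<phi>) j * add_poch (odd_theta p) (2 * h) (\<alpha> + 2 * h - \<epsilon>) j
          * add_poch (odd_theta p) (2 * h) \<alpha> j * add_poch (odd_theta p) (2 * h) (\<alpha> + h) j \<noteq> 0"
      using gen_om1 unfolding qm \<mu> args4 Tq2 N_def[symmetric] by simp
  qed
qed

end
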